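(* Let $E$ be a uniformly smooth and uniformly convex real Banach space. Let $\{T_k\}_{k\ge 1}$ be mappings from $E$ into itself, and let $\Gamma$ be a family of closed generalized nonexpansive mappings on $E$ such that $$\bigcap_{k=1}^{\infty}\operatorname{Fix}(T_k)=F(\Gamma)\neq\varnothing .$$ Assume that $\{T_k\}$ satisfies the NST-condition with $\Gamma$, and that $\{T_k\}$ has the vanishing-error $\phi$-Fejér property with respect to $F(\Gamma)$, with error sequence $\{\varepsilon_k\}\subset[0,\infty)$, $\varepsilon_k\to 0$, i.e. $$\phi(T_kx,p)\le \phi(x,p)+\varepsilon_k\qquad\text{for all } x\in E,\ p\in F(\Gamma),\ k\ge 1 .$$ Let $\overline\alpha<1$ and $0\le \alpha_k\le\overline\alpha$ for every $k$, and let $\{\beta_k\}\subset\mathbb{R}$ be bounded. Given $v_0\in E$, set $v_1=v_0$ and $C_1=E$, and for $k\ge 1$ define $$\begin{aligned} w_k&=v_k+\beta_k(v_k-v_{k-1}),\\ y_k&=\alpha_k w_k+(1-\alpha_k)T_kw_k,\\ C_{k+1}&=\bigl\{v\in C_k:\ \phi(y_k,v)\le\phi(w_k,v)+(1-\alpha_k)\varepsilon_k\bigr\},\\ v_{k+1}&=R_{C_{k+1}}v_0, \end{aligned}$$ where $R_D$ denotes the sunny generalized nonexpansive retraction of $E$ onto $D$. Then every $C_k$ is a nonempty closed sunny generalized nonexpansive retract of $E$, so the iteration is well defined. Moreover, $v_k\to R_{F(\Gamma)}v_0$ strongly (in norm).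
   Context: $E^*$ is the dual of $E$. The normalized duality mapping is $Jx=\{x^*\in E^*:\langle x,x^*\rangle=\|x\|^2=\|x^*\|^2\}$; it is single-valued when $E$ is smooth. For $E$ smooth, $\phi(x,y):=\|x\|^2-2\langle x,Jy\rangle+\|y\|^2$ for $x,y\in E$. $\operatorname{Fix}(T)=\{x\in E: Tx=x\}$. For a family $\Gamma$ of mappings $E\to E$, $F(\Gamma):=\bigcap_{T\in\Gamma}\operatorname{Fix}(T)$. A mapping $T:E\to E$ is closed if its graph $\{(x,Tx):x\in E\}$ is closed in $E\times E$ (norm topology). A mapping $T:E\to E$ is generalized nonexpansive if $\operatorname{Fix}(T)\ne\varnothing$ and $\phi(Tx,p)\le\phi(x,p)$ for all $x\in E$, $p\in\operatorname{Fix}(T)$. Let $D\subset E$ be nonempty. A retraction $R_D:E\to D$ (a map of $E$ onto $D$ with $R_Dz=z$ for $z\in D$) is sunny if $R_D(R_Dx+t(x-R_Dx))=R_Dx$ for all $x\in E$, $t\ge 0$; it is generalized nonexpansive if $\phi(R_Dx,p)\le\phi(x,p)$ for all $x\in E$, $p\in D$. $D$ is a sunny generalized nonexpansive retract of $E$ if a sunny generalized nonexpansive retraction of $E$ onto $D$ exists; in a smooth and strictly convex space it is then known to be unique and is denoted $R_D$. NST-condition: given $\{T_k\}_{k\ge1}$ and $\Gamma$ with $\bigcap_k\operatorname{Fix}(T_k)=F(\Gamma)\ne\varnothing$, the sequence $\{T_k\}$ satisfies the NST-condition with $\Gamma$ if for every bounded sequence $\{x_k\}\subset E$, $\|x_k-T_kx_k\|\to0$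 implies $\|x_k-Tx_k\|\to 0$ for every $T\in\Gamma$. *)

theory Defs
  imports "HOL-Analysis.Analysis"
begin

definition uniformly_convex :: "'a::real_normed_vector itself \<Rightarrow> bool" where
  "uniformly_convex _ \<longleftrightarrow>
     (\<forall>e::real. 0 < e \<and> e \<le> 2 \<longrightarrow>
        (\<exists>d>0. \<forall>x y::'a. norm x = 1 \<and> norm y = 1 \<and> norm (x - y) \<ge> e \<longrightarrow>
           norm ((1/2) *\<^sub>R (x + y)) \<le> 1 - d))"

(* The norm is Gateaux differentiable on the unit sphere, with the limit of the
   difference quotients attained uniformly in the point x and the direction y. *)
definition uniformly_smooth :: "'a::real_normed_vector itself \<Rightarrow> bool" where
  "uniformly_smooth _ \<longleftrightarrow>
     (\<exists>l :: 'a \<times> 'a \<Rightarrow> real.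
        uniform_limit (sphere 0 1 \<times> sphere 0 1)
          (\<lambda>t (x, y). (norm (x + t *\<^sub>R y) - norm x) / t) l (at 0))"

definition duality_map :: "'a::real_normed_vector \<Rightarrow> ('a \<Rightarrow>\<^sub>L real) set" where
  "duality_map x = {f. blinfun_apply f x = (norm x)\<^sup>2 \<and> (norm x)\<^sup>2 = (norm f)\<^sup>2}"

(* Meaningful only when the space is smooth, so that duality_map y is a singleton. *)
definition phi :: "'a::real_normed_vector \<Rightarrow> 'a \<Rightarrow> real" where
  "phi x y = (norm x)\<^sup>2 - 2 * blinfun_apply (THE f. f \<in> duality_map y) x + (norm y)\<^sup>2"

definition Fix :: "('a \<Rightarrow> 'a) \<Rightarrow> 'a set" where
  "Fix T = {x. T x = x}"

definition common_fix :: "('a \<Rightarrow> 'a) set \<Rightarrow> 'a set" where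
  "common_fix \<Gamma> = (\<Inter>T\<in>\<Gamma>. Fix T)"

definition closed_map_graph :: "('a::topological_space \<Rightarrow> 'a) \<Rightarrow> bool" where
  "closed_map_graph T \<longleftrightarrow> closed {(x, T x) | x. True}"

definition generalized_nonexpansive :: "('a::real_normed_vector \<Rightarrow> 'a) \<Rightarrow> bool" where
  "generalized_nonexpansive T \<longleftrightarrow>
     Fix T \<noteq> {} \<and> (\<forall>x. \<forall>p\<in>Fix T. phi (T x) p \<le> phi x p)"

definition sunny_gn_retraction :: "('a::real_normed_vector \<Rightarrow> 'a) \<Rightarrow> 'a set \<Rightarrow> bool" where
  "sunny_gn_retraction R D \<longleftrightarrow>
     range R = D \<and> (\<forall>z\<in>D. R z = z) \<and>
     (\<forall>x. \<forall>t\<ge>0. R (R x + t *\<^sub>R (x - R x)) = R x) \<and>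
     (\<forall>x. \<forall>p\<in>D. phi (R x) p \<le> phi x p)"

definition sunny_gn_retract :: "'a::real_normed_vector set \<Rightarrow> bool" where
  "sunny_gn_retract D \<longleftrightarrow> (\<exists>R. sunny_gn_retraction R D)"

(* Unspecified unless D has exactly one sunny generalized nonexpansive retraction. *)
definition sgn_retraction :: "'a::real_normed_vector set \<Rightarrow> 'a \<Rightarrow> 'a" where
  "sgn_retraction D = (THE R. sunny_gn_retraction R D)"

(* Sequences indexed by k \<ge> 1 are functions on nat whose value at 0 is ignored. *)

definition NST_condition ::
    "(nat \<Rightarrow> 'a::real_normed_vector \<Rightarrow> 'a) \<Rightarrow> ('a \<Rightarrow> 'a) set \<Rightarrow> bool" where
  "NST_condition T \<Gamma> \<longleftrightarrow>
     (\<forall>x :: nat \<Rightarrow> 'a. bounded (x ` {1..}) \<and> (\<lambda>k. norm (x k - T k (x k))) \<longlonglongrightarrow> 0 \<longrightarrow>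
        (\<forall>S\<in>\<Gamma>. (\<lambda>k. norm (x k - S (x k))) \<longlonglongrightarrow> 0))"

definition vanishing_error_phi_Fejer ::
    "(nat \<Rightarrow> 'a::real_normed_vector \<Rightarrow> 'a) \<Rightarrow> 'a set \<Rightarrow> (nat \<Rightarrow> real) \<Rightarrow> bool" where
  "vanishing_error_phi_Fejer T F \<epsilon> \<longleftrightarrow>
     (\<forall>k\<ge>1. 0 \<le> \<epsilon> k) \<and> \<epsilon> \<longlonglongrightarrow> 0 \<and>
     (\<forall>x. \<forall>p\<in>F. \<forall>k\<ge>1. phi (T k x) p \<le> phi x p + \<epsilon> k)"

definition shrinking_iteration ::
    "(nat \<Rightarrow> 'a::real_normed_vector \<Rightarrow> 'a) \<Rightarrow> (nat \<Rightarrow> real) \<Rightarrow> (nat \<Rightarrow> real) \<Rightarrow> (nat \<Rightarrow> real) \<Rightarrow> 'a \<Rightarrow>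
     (nat \<Rightarrow> 'a) \<Rightarrow> (nat \<Rightarrow> 'a) \<Rightarrow> (nat \<Rightarrow> 'a) \<Rightarrow> (nat \<Rightarrow> 'a set) \<Rightarrow> bool" where
  "shrinking_iteration T \<alpha> \<beta> \<epsilon> v0 v w y C \<longleftrightarrow>
     v 0 = v0 \<and> v 1 = v0 \<and> C 1 = UNIV \<and>
     (\<forall>k\<ge>1.
        w k = v k + \<beta> k *\<^sub>R (v k - v (k - 1)) \<and>
        y k = \<alpha> k *\<^sub>R w k + (1 - \<alpha> k) *\<^sub>R T k (w k) \<and>
        C (k + 1) = {u \<in> C k. phi (y k) u \<le> phi (w k) u + (1 - \<alpha> k) * \<epsilon> k} \<and>
        v (k + 1) = sgn_retraction (C (k + 1)) v0)"

end

theory Submission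
  imports Defs
begin

text \<open>
  Everything is measured by Alber's functional \<open>V f x = \<parallel>f\<parallel>\<^sup>2 - 2 f x + \<parallel>x\<parallel>\<^sup>2\<close> on pairs of a
  functional and a vector (\<open>alber\<close> below). It is nonnegative, it vanishes exactly when \<open>f\<close> belongs
  to the duality map of \<open>x\<close>, and \<open>\<phi> x y = V (J y) x\<close>. The geometry of the space enters through
  two mirror-image facts: by uniform smoothness, two functionals with small \<open>V\<close> at the same bounded
  vector are close (\<open>functionals_close\<close>); by uniform convexity, two vectors with small \<open>V\<close>
  against the same bounded functional are close (\<open>vectors_close\<close>). Together they make the duality
  map \<open>J\<close> (\<open>dmap\<close> below) a homeomorphism onto the dual space, once \<open>J\<close> is known to be onto.

  For fixed \<open>a\<close>, \<open>b\<close> and \<open>c\<close>, the inequality \<open>\<phi> a z \<le> \<phi> b z + c\<close> is affine in \<open>J z\<close>. Hence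
  the sets \<open>C k\<close> are preimages under \<open>J\<close> of closed convex sets of functionals. The same is true of
  the fixed point set of a generalized nonexpansive \<open>S\<close>, because this set consists of those \<open>z\<close>
  with \<open>\<phi> (S x) z \<le> \<phi> x z\<close> for all \<open>x\<close>: take \<open>x = z\<close> to see that such a \<open>z\<close> is fixed.
  On such a set \<open>D\<close> the minimizer \<open>z\<close> of \<open>\<phi> x\<close> is found by minimizing \<open>\<parallel>f\<parallel>\<^sup>2 - 2 f x\<close> over a
  closed convex subset of the dual, which is uniformly convex. The minimizer is characterized by the
  variational inequality \<open>(J z - J p) (x - z) \<ge> 0\<close> for all \<open>p \<in> D\<close>, and so is the value at \<open>x\<close>
  of any sunny generalized nonexpansive retraction onto \<open>D\<close>; this gives existence and uniqueness
  of \<open>R\<^sub>D\<close> together with \<open>\<phi> (R\<^sub>D x) p + \<phi> x (R\<^sub>D x) \<le> \<phi> x p\<close>.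

  Convergence then goes as follows. By the Fejer property and the convexity of \<open>\<phi>\<close> in its first
  argument, every \<open>C k\<close> contains the common fixed point set \<open>F\<close>. So \<open>\<phi> v0 (v k)\<close> increases and is
  bounded by its values on \<open>F\<close>, and the last inequality makes \<open>v\<close> a Cauchy sequence; its limit
  \<open>u\<close> satisfies \<open>\<phi> v0 u \<le> \<phi> v0 p\<close> on \<open>F\<close>. The extrapolated points \<open>w k\<close> have the same limit,
  and since \<open>v (k + 1) \<in> C (k + 1)\<close> forces \<open>\<phi> (y k) (v (k + 1)) \<longlongrightarrow> 0\<close>, so do the \<open>y k\<close>.
  As \<open>1 - \<alpha> k\<close> stays away from \<open>0\<close>, the residuals \<open>w k - T k (w k)\<close> vanish. The NST-condition
  and the closed graphs put \<open>u\<close> into \<open>F\<close>, and there it is the minimizer \<open>R\<^sub>F v0\<close>.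
\<close>

section \<open>Alber's functional and uniform smoothness\<close>

definition alber :: "('a::real_normed_vector \<Rightarrow>\<^sub>L real) \<Rightarrow> 'a \<Rightarrow> real" where
  "alber f x = (norm f)\<^sup>2 - 2 * blinfun_apply f x + (norm x)\<^sup>2"

lemma blinfun_le_norm: "blinfun_apply f x \<le> norm f * norm x" for f :: "'a::real_normed_vector \<Rightarrow>\<^sub>L real"
  using norm_blinfun[of f x] by (simp add: abs_le_iff)

lemma alber_ge: "(norm f - norm x)\<^sup>2 \<le> alber f x"
  using blinfun_le_norm[of f x] by (simp add: alber_def power2_eq_square algebra_simps)

lemma alber_nonneg: "0 \<le> alber f x"
  using alber_ge[of f x] by (meson order_trans zero_le_power2)

lemma alber_eq_0_iff: "alber f x = 0 \<longleftrightarrow> f \<in> duality_map x"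
proof
  assume "alber f x = 0"
  moreover from this have "norm f = norm x" using alber_ge[of f x] by simp
  ultimately show "f \<in> duality_map x" by (simp add: alber_def duality_map_def)
qed (simp add: alber_def duality_map_def)

text \<open>
  Adding the difference quotients for \<open>t\<close> and \<open>- t\<close> eliminates the unknown derivative, so that
  only a bound on symmetric second differences is left.
\<close>
lemma uniformly_smooth_second_difference:
  assumes "uniformly_smooth TYPE('a::real_normed_vector)" "0 < e"
  obtains d where "0 < d"
    "\<And>(x::'a) y t. \<lbrakk>norm x = 1; norm y = 1; 0 < t; t < d\<rbrakk> \<Longrightarrow>
       norm (x + t *\<^sub>R y) + norm (x - t *\<^sub>R y) - 2 \<le> e * t"
proof -
  from assms(1) obtain l where l: "uniform_limit (sphere 0 1 \<times> sphere (0::'a) 1)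
          (\<lambda>t (x, y). (norm (x + t *\<^sub>R y) - norm x) / t) l (at 0)"
    unfolding uniformly_smooth_def by blast
  have "0 < e / 2" using assms(2) by simp
  from uniform_limitD[OF l this] obtain d where d: "0 < d"
    and close: "\<And>t x y. \<lbrakk>t \<noteq> 0; \<bar>t\<bar> < d; norm (x::'a) = 1; norm y = 1\<rbrakk> \<Longrightarrow>
       \<bar>(norm (x + t *\<^sub>R y) - norm x) / t - l (x, y)\<bar> < e / 2"
    unfolding eventually_at by (auto simp: dist_real_def)
  show thesis
  proof (rule that[OF d])
    fix x y :: 'a and t :: real
    assume xy: "norm x = 1" "norm y = 1" and t: "0 < t" "t < d"
    have "\<bar>(norm (x + t *\<^sub>R y) - 1) / t - l (x, y)\<bar> < e / 2"
      using close[of t x y] xy t by auto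
    then have "(norm (x + t *\<^sub>R y) - 1) / t < l (x, y) + e / 2" by linarith
    moreover have "\<bar>- ((norm (x - t *\<^sub>R y) - 1) / t) - l (x, y)\<bar> < e / 2"
      using close[of "- t" x y] xy t by auto
    then have "(norm (x - t *\<^sub>R y) - 1) / t < - l (x, y) + e / 2" by linarith
    ultimately have "(norm (x + t *\<^sub>R y) + norm (x - t *\<^sub>R y) - 2) / t \<le> e"
      by (simp add: add_divide_distrib diff_divide_distrib)
    then show "norm (x + t *\<^sub>R y) + norm (x - t *\<^sub>R y) - 2 \<le> e * t"
      using t by (simp only: pos_divide_le_eq)
  qed
qed

text \<open>
  Passing to the square of the norm removes the restriction to the unit sphere: for \<open>z\<close> away from
  \<open>0\<close> the estimate is the one for unit vectors, scaled by \<open>\<parallel>z\<parallel>\<close>, and for \<open>z\<close> near \<open>0\<close> it is trivial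
  because the squared norm has a small Lipschitz constant there.
\<close>
lemma uniformly_smooth_norm_square:
  fixes M e :: real
  assumes "uniformly_smooth TYPE('a::real_normed_vector)" "0 < e"
  obtains d where "0 < d"
    "\<And>(z::'a) y. \<lbrakk>norm z \<le> M; norm y \<le> d\<rbrakk> \<Longrightarrow>
       (norm (z + y))\<^sup>2 + (norm (z - y))\<^sup>2 - 2 * (norm z)\<^sup>2 \<le> e * norm y"
proof -
  define N where "N = max M 1"
  have N: "N \<ge> 1" "M \<le> N" by (auto simp: N_def)
  have "0 < e / (4 * N)" using assms(2) N by simp
  from uniformly_smooth_second_difference[OF assms(1) this] obtain d0 where d0: "0 < d0"
    and sd: "\<And>(x::'a) y t. \<lbrakk>norm x = 1; norm y = 1; 0 < t; t < d0\<rbrakk> \<Longrightarrow>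
       norm (x + t *\<^sub>R y) + norm (x - t *\<^sub>R y) - 2 \<le> e / (4 * N) * t" by blast
  define d where "d = min (e / 4) (d0 * (e / 16))"
  have d: "0 < d" using d0 assms(2) by (simp add: d_def)
  show thesis
  proof (rule that[OF d])
    fix z y :: 'a assume z: "norm z \<le> M" and y: "norm y \<le> d"
    define a b c where "a = norm (z + y)" and "b = norm (z - y)" and "c = norm z"
    have c0: "0 \<le> c" by (simp add: c_def)
    have ac: "\<bar>a - c\<bar> \<le> norm y"
      using norm_triangle_ineq3[of "z + y" z] by (simp add: a_def c_def)
    have bc: "\<bar>b - c\<bar> \<le> norm y"
      using norm_triangle_ineq3[of "z - y" z] by (simp add: b_def c_def)
    have sq: "(a - c)\<^sup>2 \<le> (norm y)\<^sup>2" "(b - c)\<^sup>2 \<le> (norm y)\<^sup>2"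
      using ac bc by (metis abs_ge_zero power2_abs power_mono)+
    have y2: "(norm y)\<^sup>2 \<le> e / 4 * norm y"
      unfolding power2_eq_square using y by (intro mult_right_mono) (auto simp: d_def)
    have split: "a\<^sup>2 + b\<^sup>2 - 2 * c\<^sup>2 = 2 * c * (a + b - 2 * c) + (a - c)\<^sup>2 + (b - c)\<^sup>2"
      by (simp add: power2_eq_square algebra_simps)
    \<comment> \<open>The two squared terms of \<open>split\<close> cost \<open>e / 4\<close> each; the second difference of the norm
      may therefore take the remaining \<open>e / 2\<close>.\<close>
    have "2 * c * (a + b - 2 * c) \<le> e / 2 * norm y"
    proof (cases "c \<le> e / 8 \<or> y = 0")
      case True
      show ?thesis
      proof (cases "y = 0")
        case True
        then show ?thesis by (simp add: a_def b_def c_def)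
      next
        case False
        have "2 * c * (a + b - 2 * c) \<le> 2 * c * (2 * norm y)"
          using ac bc c0 by (intro mult_left_mono) auto
        also have "\<dots> \<le> 2 * (e / 8) * (2 * norm y)"
          using True False by (intro mult_right_mono mult_left_mono) auto
        finally show ?thesis by simp
      qed
    next
      case False
      then have c: "c > e / 8" and y0: "norm y > 0" by auto
      have cpos: "c > 0" using c assms(2) by simp
      let ?t = "norm y / c"
      have t0: "?t > 0" using y0 cpos by simp
      have "norm y < d0 * c"
      proof -
        have "norm y \<le> d0 * (e / 16)" using y by (simp add: d_def)
        also have "\<dots> < d0 * c" using c d0 assms(2) by (intro mult_strict_left_mono) auto
        finally show ?thesis .
      qed
      then have t1: "?t < d0" using cpos by (simp add: field_simps)
      let ?x = "z /\<^sub>R c" and ?u = "y /\<^sub>R norm y"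
      have "?t *\<^sub>R ?u = y /\<^sub>R c" using y0 by (simp add: divide_inverse)
      then have xp: "?x + ?t *\<^sub>R ?u = (z + y) /\<^sub>R c" and xm: "?x - ?t *\<^sub>R ?u = (z - y) /\<^sub>R c"
        by (simp_all only: scaleR_right_distrib scaleR_right_diff_distrib)
      have "norm (?x + ?t *\<^sub>R ?u) + norm (?x - ?t *\<^sub>R ?u) - 2 \<le> e / (4 * N) * ?t"
      proof (rule sd[OF _ _ t0 t1])
        show "norm ?x = 1" using cpos by (simp add: c_def)
        show "norm ?u = 1" using y0 by simp
      qed
      moreover have "norm ((z + y) /\<^sub>R c) = a / c" "norm ((z - y) /\<^sub>R c) = b / c"
        using cpos by (simp_all add: a_def b_def divide_inverse_commute)
      ultimately have "a / c + b / c - 2 \<le> e / (4 * N) * ?t" unfolding xp xm by simp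
      then have "c * (a / c + b / c - 2) \<le> c * (e / (4 * N) * ?t)"
        using c0 by (rule mult_left_mono)
      moreover have "c * (a / c + b / c - 2) = a + b - 2 * c"
        using cpos by (simp add: distrib_left right_diff_distrib)
      moreover have "c * (e / (4 * N) * ?t) = e / (4 * N) * norm y" using cpos by simp
      ultimately have "a + b - 2 * c \<le> e / (4 * N) * norm y" by simp
      then have "2 * c * (a + b - 2 * c) \<le> 2 * c * (e / (4 * N) * norm y)"
        using c0 by (intro mult_left_mono) auto
      also have "\<dots> \<le> 2 * N * (e / (4 * N) * norm y)"
        using z N assms(2) by (intro mult_right_mono mult_left_mono) (auto simp: c_def)
      also have "\<dots> = e / 2 * norm y" using N by simp
      finally show ?thesis .
    qed
    then show "(norm (z + y))\<^sup>2 + (norm (z - y))\<^sup>2 - 2 * (norm z)\<^sup>2 \<le> e * norm y"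
      using split sq y2 unfolding a_def b_def c_def by linarith
  qed
qed

text \<open>
  Since \<open>V f (z + y) \<ge> 0\<close> and \<open>V g (z - y) \<ge> 0\<close>, the value \<open>(f - g) y\<close> is at most half of
  \<open>V f z + V g z\<close> plus half of the symmetric second difference of the squared norm at \<open>z\<close>, which
  uniform smoothness controls. Taking \<open>y\<close> on a sphere of fixed radius gives a bound on the norm
  of \<open>f - g\<close>. The lemma serves three times: for uniform convexity of the dual, for uniqueness
  in the duality map, and for continuity of \<open>J\<close>.
\<close>
lemma functionals_close:
  fixes M e :: real
  assumes "uniformly_smooth TYPE('a::real_normed_vector)" "0 < e"
  obtains d where "0 < d"
    "\<And>(z::'a) f g. \<lbrakk>norm z \<le> M; alber f z + alber g z \<le> d\<rbrakk> \<Longrightarrow> norm (f - g) \<le> e"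
proof -
  from uniformly_smooth_norm_square[OF assms] obtain d where d: "0 < d"
    and sd: "\<And>(z::'a) y. \<lbrakk>norm z \<le> M; norm y \<le> d\<rbrakk> \<Longrightarrow>
       (norm (z + y))\<^sup>2 + (norm (z - y))\<^sup>2 - 2 * (norm z)\<^sup>2 \<le> e * norm y" by metis
  have "0 < e * d" using d assms(2) by simp
  then show thesis
  proof (rule that)
    fix z :: 'a and f g
    assume z: "norm z \<le> M" and V: "alber f z + alber g z \<le> e * d"
    have dir: "blinfun_apply (f - g) y \<le> e * norm y" if y: "norm y = d" for y
    proof -
      have "0 \<le> alber f (z + y)" "0 \<le> alber g (z - y)" by (rule alber_nonneg)+
      then show ?thesis
        using sd[OF z, of y] y V
        by (simp add: alber_def blinfun.bilinear_simps)
    qed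
    show "norm (f - g) \<le> e"
    proof (rule norm_blinfun_bound)
      fix y :: 'a
      show "norm (blinfun_apply (f - g) y) \<le> e * norm y"
      proof (cases "y = 0")
        case False
        let ?s = "d / norm y"
        have s: "?s > 0" using d False by simp
        have n: "norm (?s *\<^sub>R y) = d" "norm (- ?s *\<^sub>R y) = d" using d False by auto
        have "?s * blinfun_apply (f - g) y \<le> ?s * (e * norm y)"
          using dir[OF n(1)] n(1) False by (simp add: blinfun.scaleR_right mult.commute)
        moreover have "?s * (- blinfun_apply (f - g) y) \<le> ?s * (e * norm y)"
          using dir[OF n(2)] n(2) False by (simp add: blinfun.scaleR_right blinfun.minus_right mult.commute)
        ultimately show ?thesis using s by (simp only: mult_le_cancel_left_pos real_norm_def abs_le_iff)
      qed simp
    qed (use assms(2) in simp)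
  qed
qed

lemma norming_vector:
  fixes f :: "'a::real_normed_vector \<Rightarrow>\<^sub>L real"
  assumes "c < norm f" "0 \<le> c"
  obtains z where "norm z = 1" "c < blinfun_apply f z"
proof -
  have "\<exists>z. c * norm z < norm (blinfun_apply f z)"
    using norm_blinfun_bound[of c f] assms by (meson not_less)
  then obtain y where y: "c * norm y < \<bar>blinfun_apply f y\<bar>" by auto
  have y0: "y \<noteq> 0" using y by auto
  define s where "s = sgn (blinfun_apply f y) / norm y"
  show thesis
  proof (rule that)
    have "blinfun_apply f y \<noteq> 0" using y assms(2) by (auto simp: not_less mult_less_0_iff)
    then show "norm (s *\<^sub>R y) = 1" using y0 by (simp add: s_def abs_sgn_eq)
    have "blinfun_apply f (s *\<^sub>R y) = \<bar>blinfun_apply f y\<bar> / norm y"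
      by (simp add: s_def blinfun.scaleR_right abs_sgn)
    then show "c < blinfun_apply f (s *\<^sub>R y)" using y y0 by (simp add: pos_less_divide_eq)
  qed
qed

text \<open>
  If the midpoint of two unit functionals has norm near \<open>1\<close>, then both are nearly normed by a common
  unit vector, so both have small \<open>V\<close> at it.
\<close>
theorem dual_uniformly_convex:
  assumes "uniformly_smooth TYPE('a::real_normed_vector)"
  shows "uniformly_convex TYPE('a \<Rightarrow>\<^sub>L real)"
  unfolding uniformly_convex_def
proof (intro allI impI)
  fix e :: real assume e: "0 < e \<and> e \<le> 2"
  then have "0 < e / 2" by simp
  from functionals_close[OF assms this] obtain d where d: "0 < d"
    and close: "\<And>(z::'a) f g. \<lbrakk>norm z \<le> 1; alber f z + alber g z \<le> d\<rbrakk> \<Longrightarrow> norm (f - g) \<le> e / 2"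
    by metis
  define r where "r = min 1 (d / 4)"
  have r: "r > 0" "r \<le> 1" "4 * r \<le> d" using d by (auto simp: r_def)
  show "\<exists>d>0. \<forall>f g::'a \<Rightarrow>\<^sub>L real. norm f = 1 \<and> norm g = 1 \<and> e \<le> norm (f - g) \<longrightarrow>
          norm ((1/2) *\<^sub>R (f + g)) \<le> 1 - d"
  proof (intro exI[of _ r] conjI allI impI r)
    fix f g :: "'a \<Rightarrow>\<^sub>L real" assume fg: "norm f = 1 \<and> norm g = 1 \<and> e \<le> norm (f - g)"
    show "norm ((1/2) *\<^sub>R (f + g)) \<le> 1 - r"
    proof (rule ccontr)
      assume "\<not> ?thesis"
      then have "2 - 2 * r < norm (f + g)" by simp
      then obtain z where z: "norm z = 1" "2 - 2 * r < blinfun_apply (f + g) z"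
        using norming_vector[of "2 - 2 * r" "f + g"] r by auto
      have "alber f z + alber g z \<le> d"
        using z fg r by (simp add: alber_def blinfun.add_left)
      then have "norm (f - g) \<le> e / 2" using close[of z f g] z by simp
      then show False using fg e by simp
    qed
  qed
qed

text \<open>
  The Gateaux derivative of the norm at \<open>x\<close> is the required functional: as a limit of difference
  quotients of a convex function it is subadditive, and the two-sided limit makes it odd, hence
  additive.
\<close>
lemma duality_map_unit:
  fixes x :: "'a::real_normed_vector"
  assumes "uniformly_smooth TYPE('a)" "norm x = 1"
  obtains f where "f \<in> duality_map x"
proof -
  from assms(1) obtain l where l: "uniform_limit (sphere 0 1 \<times> sphere (0::'a) 1)
          (\<lambda>t (x, y). (norm (x + t *\<^sub>R y) - norm x) / t) l (at 0)"
    unfolding uniformly_smooth_def by blast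
  define Q where "Q = (\<lambda>y t. (norm (x + t *\<^sub>R y) - 1) / t)"
  have "\<exists>L. (Q y \<longlongrightarrow> L) (at 0)" for y
  proof (cases "y = 0")
    case True
    then show ?thesis using assms(2) by (intro exI[of _ 0]) (simp add: Q_def)
  next
    case False
    define u where "u = y /\<^sub>R norm y"
    have u: "norm u = 1" using False by (simp add: u_def)
    have "(Q u \<longlongrightarrow> l (x, u)) (at 0)"
      using tendsto_uniform_limitI[OF l, of "(x, u)"] assms(2) u by (simp add: Q_def)
    moreover have "filterlim (\<lambda>t. norm y * t) (at 0) (at 0)"
      using False by (auto simp: filterlim_at eventually_at_filter intro!: tendsto_eq_intros)
    ultimately have "((\<lambda>t. Q u (norm y * t)) \<longlongrightarrow> l (x, u)) (at 0)"
      by (rule filterlim_compose)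
    then have "((\<lambda>t. norm y * Q u (norm y * t)) \<longlongrightarrow> norm y * l (x, u)) (at 0)"
      by (intro tendsto_intros)
    moreover have "(norm y * t) *\<^sub>R u = t *\<^sub>R y" for t
      using False by (simp add: u_def)
    then have "(\<lambda>t. norm y * Q u (norm y * t)) = Q y"
      using False by (simp add: Q_def fun_eq_iff)
    ultimately show ?thesis by auto
  qed
  then obtain L where L: "\<And>y. (Q y \<longlongrightarrow> L y) (at 0)" by metis
  have scale: "L (c *\<^sub>R y) = c * L y" for c y
  proof (cases "c = 0")
    case True
    have "(Q 0 \<longlongrightarrow> 0) (at 0)" using assms(2) by (simp add: Q_def)
    then have "L 0 = 0" using LIM_unique[OF L] by blast
    then show ?thesis using True by simp
  next
    case False
    have "filterlim (\<lambda>t. c * t) (at 0) (at 0)"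
      using False by (auto simp: filterlim_at eventually_at_filter intro!: tendsto_eq_intros)
    with L have "((\<lambda>t. Q y (c * t)) \<longlongrightarrow> L y) (at 0)"
      by (rule filterlim_compose)
    then have "((\<lambda>t. c * Q y (c * t)) \<longlongrightarrow> c * L y) (at 0)"
      by (intro tendsto_intros)
    moreover have "(\<lambda>t. c * Q y (c * t)) = Q (c *\<^sub>R y)"
      using False by (auto simp: Q_def fun_eq_iff mult.commute)
    ultimately show ?thesis using LIM_unique[OF L[of "c *\<^sub>R y"]] by simp
  qed
  have right: "(Q y \<longlongrightarrow> L y) (at_right 0)" for y
    using L[of y] by (simp add: filterlim_at_split)
  have subadd: "L (y + z) \<le> L y + L z" for y z
  proof -
    have "L (y + z) \<le> (L (2 *\<^sub>R y) + L (2 *\<^sub>R z)) / 2"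
    proof (rule tendsto_le[OF _ _ right])
      show "((\<lambda>t. (Q (2 *\<^sub>R y) t + Q (2 *\<^sub>R z) t) / 2) \<longlongrightarrow> (L (2 *\<^sub>R y) + L (2 *\<^sub>R z)) / 2) (at_right 0)"
        by (intro tendsto_intros right) simp
      show "\<forall>\<^sub>F t in at_right 0. Q (y + z) t \<le> (Q (2 *\<^sub>R y) t + Q (2 *\<^sub>R z) t) / 2"
        unfolding eventually_at_right_field
      proof (intro exI[of _ 1] conjI allI impI)
        fix t :: real assume t: "0 < t"
        have "2 * norm (x + t *\<^sub>R (y + z)) = norm ((x + t *\<^sub>R 2 *\<^sub>R y) + (x + t *\<^sub>R 2 *\<^sub>R z))"
        proof -
          have "(x + t *\<^sub>R 2 *\<^sub>R y) + (x + t *\<^sub>R 2 *\<^sub>R z) = 2 *\<^sub>R (x + t *\<^sub>R (y + z))"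
            by (simp add: scaleR_2 scaleR_right_distrib flip: scaleR_add_left)
          then show ?thesis by simp
        qed
        also have "\<dots> \<le> norm (x + t *\<^sub>R 2 *\<^sub>R y) + norm (x + t *\<^sub>R 2 *\<^sub>R z)"
          by (rule norm_triangle_ineq)
        finally have "norm (x + t *\<^sub>R (y + z)) - 1 \<le>
            ((norm (x + t *\<^sub>R 2 *\<^sub>R y) - 1) + (norm (x + t *\<^sub>R 2 *\<^sub>R z) - 1)) / 2" by simp
        from divide_right_mono[OF this, of t] t
        show "Q (y + z) t \<le> (Q (2 *\<^sub>R y) t + Q (2 *\<^sub>R z) t) / 2"
          unfolding Q_def by (simp only: add_divide_distrib[symmetric] divide_divide_eq_left mult.commute[of 2 t] less_imp_le)
      qed simp
    qed simp
    then show ?thesis by (simp add: scale)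
  qed
  have bound: "L y \<le> norm y" for y
  proof (rule tendsto_upperbound[OF right])
    show "\<forall>\<^sub>F t in at_right 0. Q y t \<le> norm y"
      unfolding eventually_at_right_field
    proof (intro exI[of _ 1] conjI allI impI)
      fix t :: real assume t: "0 < t"
      have "norm (x + t *\<^sub>R y) \<le> 1 + t * norm y"
        using norm_triangle_ineq[of x "t *\<^sub>R y"] assms(2) t by simp
      then show "Q y t \<le> norm y" using t by (simp add: Q_def field_simps)
    qed simp
  qed simp
  have neg: "L (- y) = - L y" for y using scale[of "-1" y] by simp
  have lin: "bounded_linear L"
  proof (rule bounded_linear_intro)
    fix y z
    show "L (y + z) = L y + L z"
      using subadd[of y z] subadd[of "y + z" "- z"] by (simp add: neg)
    show "norm (L y) \<le> norm y * 1"
      using bound[of y] bound[of "- y"] by (simp add: neg)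
  qed (simp add: scale)
  have "L x = 1"
  proof -
    have "Q x t = 1" if "0 < t" for t
    proof -
      have "x + t *\<^sub>R x = (1 + t) *\<^sub>R x" by (simp add: algebra_simps)
      then show ?thesis using assms(2) that by (simp add: Q_def)
    qed
    then have "(Q x \<longlongrightarrow> 1) (at_right 0)"
      by (intro tendsto_eventually) (auto simp: eventually_at_right_field intro!: exI[of _ 1])
    then show ?thesis using tendsto_unique[OF _ right] by (metis trivial_limit_at_right_real)
  qed
  define f where "f = Blinfun L"
  have f: "blinfun_apply f = L" using lin by (simp add: f_def bounded_linear_Blinfun_apply)
  have "norm f \<le> 1"
    by (rule norm_blinfun_bound) (use bound[of "- _"] bound in \<open>auto simp: f neg abs_le_iff\<close>)
  moreover have "1 \<le> norm f"
    using blinfun_le_norm[of f x] assms(2) \<open>L x = 1\<close> by (simp add: f)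
  ultimately have "norm f = 1" by simp
  then show thesis
    using that[of f] \<open>L x = 1\<close> assms(2) by (simp add: duality_map_def f)
qed

lemma duality_map_nonempty:
  fixes x :: "'a::real_normed_vector"
  assumes "uniformly_smooth TYPE('a)"
  shows "duality_map x \<noteq> {}"
proof (cases "x = 0")
  case True
  then have "0 \<in> duality_map x" by (simp add: duality_map_def)
  then show ?thesis by blast
next
  case False
  then have "norm (x /\<^sub>R norm x) = 1" by simp
  from duality_map_unit[OF assms this] obtain f where f: "f \<in> duality_map (x /\<^sub>R norm x)" .
  then have "norm f = 1" "blinfun_apply f x = norm x"
    using False by (auto simp: duality_map_def blinfun.scaleR_right field_simps abs_square_eq_1)
  then have "norm x *\<^sub>R f \<in> duality_map x"
    by (simp add: duality_map_def blinfun.scaleR_left power2_eq_square)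
  then show ?thesis by blast
qed

lemma duality_map_singleton:
  fixes x :: "'a::real_normed_vector"
  assumes "uniformly_smooth TYPE('a)"
  shows "\<exists>!f. f \<in> duality_map x"
proof (rule ex_ex1I)
  show "\<exists>f. f \<in> duality_map x" using duality_map_nonempty[OF assms] by blast
  fix f g assume "f \<in> duality_map x" "g \<in> duality_map x"
  then have V: "alber f x + alber g x = 0" by (simp add: alber_eq_0_iff[THEN iffD2])
  have "norm (f - g) \<le> e" if e: "0 < e" for e
  proof -
    from functionals_close[OF assms e, of "norm x"] obtain d where "0 < d"
      and d: "\<And>(z::'a) f g. \<lbrakk>norm z \<le> norm x; alber f z + alber g z \<le> d\<rbrakk> \<Longrightarrow> norm (f - g) \<le> e" by metis
    then show ?thesis using d[of x f g] V by (metis order_refl order_less_imp_le)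
  qed
  then have "norm (f - g) \<le> 0" by (rule field_le_epsilon) simp
  then show "f = g" by simp
qed

section \<open>Uniform convexity and quadratic minimization\<close>

text \<open>
  The quantity \<open>2 \<parallel>x\<parallel>\<^sup>2 + 2 \<parallel>y\<parallel>\<^sup>2 - \<parallel>x + y\<parallel>\<^sup>2\<close> vanishes on the diagonal and, by the triangle
  inequality, dominates \<open>(\<parallel>x\<parallel> - \<parallel>y\<parallel>)\<^sup>2\<close>. So if it is small, the two norms are close, and after
  normalization the definition of uniform convexity applies. This form suits bounded sets and
  quadratic functionals.
\<close>
lemma uniformly_convex_midpoint:
  fixes M e :: real
  assumes "uniformly_convex TYPE('a::real_normed_vector)" "0 < e"
  obtains d where "0 < d"
    "\<And>x y::'a. \<lbrakk>norm x \<le> M; norm y \<le> M;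
       2 * (norm x)\<^sup>2 + 2 * (norm y)\<^sup>2 - (norm (x + y))\<^sup>2 \<le> d\<rbrakk> \<Longrightarrow> norm (x - y) \<le> e"
proof -
  define N where "N = max M 1"
  have N: "N \<ge> 1" "M \<le> N" by (auto simp: N_def)
  define e0 where "e0 = min 2 (e / (2 * N))"
  have "0 < e0 \<and> e0 \<le> 2" using N assms(2) by (simp add: e0_def)
  with assms(1) obtain d0 where d0: "0 < d0"
    and uc: "\<And>x y::'a. \<lbrakk>norm x = 1; norm y = 1; norm (x - y) \<ge> e0\<rbrakk> \<Longrightarrow>
       norm ((1/2) *\<^sub>R (x + y)) \<le> 1 - d0"
    unfolding uniformly_convex_def by metis
  define r where "r = min d0 1"
  have r: "0 < r" "r \<le> 1" "r \<le> d0" using d0 by (auto simp: r_def)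
  define d where "d = e\<^sup>2 * r / 8"
  have d: "0 < d" using r assms(2) by (simp add: d_def)
  have ordered: "norm (x - y) \<le> e"
    if x: "norm x \<le> norm y" "norm x \<le> M"
      and D: "2 * (norm x)\<^sup>2 + 2 * (norm y)\<^sup>2 - (norm (x + y))\<^sup>2 \<le> d" for x y :: 'a
  proof (rule ccontr)
    assume "\<not> ?thesis"
    then have far: "e < norm (x - y)" by simp
    define a b where "a = norm x" and "b = norm y"
    have ab: "0 \<le> a" "a \<le> b" using x by (auto simp: a_def b_def)
    have "(norm (x + y))\<^sup>2 \<le> (a + b)\<^sup>2"
      unfolding a_def b_def by (intro power_mono norm_triangle_ineq) simp
    then have "(b - a)\<^sup>2 \<le> d"
      using D by (simp add: a_def b_def power2_eq_square algebra_simps)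
    also have "d < (e / 2)\<^sup>2"
    proof -
      have "e\<^sup>2 * r \<le> e\<^sup>2 * 1" using r by (intro mult_left_mono) auto
      moreover have "0 < e\<^sup>2" using assms(2) by simp
      ultimately show ?thesis unfolding d_def power_divide by simp
    qed
    \<comment> \<open>The norms are so close that most of the distance comes from the directions.\<close>
    finally have ba: "b - a < e / 2" using assms(2) by (intro power2_less_imp_less[of _ "e / 2"]) auto
    have a0: "a > 0"
    proof (rule ccontr)
      assume "\<not> a > 0"
      then have "x = 0" by (simp add: a_def)
      then have "norm (x - y) = b - a" by (simp add: a_def b_def)
      then show False using ba far assms(2) by simp
    qed
    define x' y' where "x' = x /\<^sub>R a" and "y' = y /\<^sub>R b"
    have x': "norm x' = 1" "x = a *\<^sub>R x'" using a0 by (auto simp: x'_def a_def)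
    have y': "norm y' = 1" "y = b *\<^sub>R y'" using less_le_trans[OF a0 ab(2)] by (auto simp: y'_def b_def)
    have "x - y = a *\<^sub>R (x' - y') + - ((b - a) *\<^sub>R y')"
      by (subst x', subst y') (simp add: algebra_simps)
    then have "norm (x - y) \<le> norm (a *\<^sub>R (x' - y')) + norm (- ((b - a) *\<^sub>R y'))"
      by (metis norm_triangle_ineq)
    also have "\<dots> = a * norm (x' - y') + (b - a)" using a0 ab y' by simp
    finally have far': "e / 2 < a * norm (x' - y')" using far ba by simp
    have "e / 4 < a"
    proof -
      have "norm (x' - y') \<le> 2" using norm_triangle_ineq4[of x' y'] x' y' by simp
      then have "a * norm (x' - y') \<le> a * 2" using a0 by (intro mult_left_mono) auto
      then show ?thesis using far' by simp
    qed
    then have "(e / 4)\<^sup>2 < a\<^sup>2" using assms(2) by (intro power_strict_mono) auto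
    then have big: "d < 4 * (a * a) * r"
    proof -
      have "e * e < 32 * (a * a)"
        using \<open>(e / 4)\<^sup>2 < a\<^sup>2\<close> mult_pos_pos[OF a0 a0] by (simp add: power2_eq_square)
      then have "e * e * r < 32 * (a * a) * r" using r by (intro mult_strict_right_mono) auto
      then show ?thesis by (simp add: d_def power2_eq_square)
    qed
    have "e / 2 < N * norm (x' - y')"
    proof -
      have "a * norm (x' - y') \<le> N * norm (x' - y')"
        using x N by (intro mult_right_mono) (auto simp: a_def)
      then show ?thesis using far' by simp
    qed
    then have "e / (2 * N) \<le> norm (x' - y')" using N by (simp add: field_simps)
    then have "norm ((1/2) *\<^sub>R (x' + y')) \<le> 1 - d0" using x' y' by (intro uc) (auto simp: e0_def)
    then have mid: "norm (x' + y') \<le> 2 * (1 - r)" using r by simp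
    have "x + y = a *\<^sub>R (x' + y') + (b - a) *\<^sub>R y'"
      by (subst x', subst y') (simp add: algebra_simps)
    then have "norm (x + y) \<le> norm (a *\<^sub>R (x' + y')) + norm ((b - a) *\<^sub>R y')"
      by (metis norm_triangle_ineq)
    also have "\<dots> = a * norm (x' + y') + (b - a)" using a0 ab y' by simp
    also have "\<dots> \<le> a * (2 * (1 - r)) + (b - a)"
      using mid a0 by (intro add_mono mult_left_mono) auto
    also have "\<dots> = a + b - 2 * a * r" by (simp add: algebra_simps)
    finally have "(norm (x + y))\<^sup>2 \<le> (a + b - 2 * a * r)\<^sup>2" by (intro power_mono) auto
    then have "2 * a\<^sup>2 + 2 * b\<^sup>2 - (a + b - 2 * a * r)\<^sup>2 \<le> d"
      using D by (simp add: a_def b_def)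
    moreover have "2 * a\<^sup>2 + 2 * b\<^sup>2 - (a + b - 2 * a * r)\<^sup>2
        = (b - a)\<^sup>2 + 4 * (a * a) * r + 4 * a * r * (b - a) + 4 * (a * a * r) * (1 - r)"
      by (simp add: power2_eq_square algebra_simps)
    moreover have "0 \<le> 4 * a * r * (b - a)" "0 \<le> 4 * (a * a * r) * (1 - r)"
      using a0 ab r by auto
    ultimately show False using big by (smt (verit) zero_le_power2)
  qed
  show thesis
  proof (rule that[OF d])
    fix x y :: 'a
    assume "norm x \<le> M" "norm y \<le> M" "2 * (norm x)\<^sup>2 + 2 * (norm y)\<^sup>2 - (norm (x + y))\<^sup>2 \<le> d"
    then show "norm (x - y) \<le> e"
      using ordered[of x y] ordered[of y x] by (simp add: norm_minus_commute add.commute) linarith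
  qed
qed

text \<open>
  A minimizing sequence is Cauchy: the midpoint of two of its members cannot lie below the infimum,
  so the defect in \<open>uniformly_convex_midpoint\<close> is small. Applied to the whole space, this shows that
  \<open>J\<close> is onto; applied to the dual, it yields the retractions.
\<close>
lemma quadratic_attains_min:
  fixes K :: "'a::banach set" and l :: "'a \<Rightarrow> real"
  assumes uc: "uniformly_convex TYPE('a)" and l: "bounded_linear l"
    and K: "closed K" "convex K" "K \<noteq> {}"
  obtains x where "x \<in> K" "\<And>y. y \<in> K \<Longrightarrow> (norm x)\<^sup>2 - 2 * l x \<le> (norm y)\<^sup>2 - 2 * l y"
proof -
  interpret l: bounded_linear l by (rule l)
  define h where "h = (\<lambda>x. (norm x)\<^sup>2 - 2 * l x)"
  obtain L where L: "\<And>x. \<bar>l x\<bar> \<le> norm x * L" using l.bounded by auto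
  have h_ge: "(norm x - L)\<^sup>2 - L\<^sup>2 \<le> h x" for x
    using L[of x] by (simp add: h_def power2_eq_square algebra_simps)
  have bdd: "bdd_below (h ` K)"
  proof (rule bdd_belowI2[of _ "- L\<^sup>2"])
    fix x show "- L\<^sup>2 \<le> h x" using h_ge[of x] zero_le_power2[of "norm x - L"] by linarith
  qed
  define m where "m = Inf (h ` K)"
  have m: "m \<le> h x" if "x \<in> K" for x unfolding m_def using that bdd by (rule cINF_lower[rotated])
  have "\<exists>x\<in>K. h x < m + 1 / (real n + 1)" for n
  proof -
    have "Inf (h ` K) < m + 1 / (real n + 1)" by (simp add: m_def)
    then show ?thesis using cINF_less_iff[OF K(3) bdd] by auto
  qed
  then obtain X where X: "\<And>n. X n \<in> K" "\<And>n. h (X n) < m + 1 / (real n + 1)" by metis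
  define M where "M = L + \<bar>m\<bar> + L\<^sup>2 + 2"
  have bounded: "norm (X n) \<le> M" for n
  proof -
    define t where "t = norm (X n) - L"
    have "1 / (real n + 1) \<le> 1" by simp
    then have t: "t\<^sup>2 \<le> m + 1 + L\<^sup>2" using X(2)[of n] h_ge[of "X n"] unfolding t_def by linarith
    have "2 * t \<le> t\<^sup>2 + 1" using zero_le_power2[of "t - 1"] by (simp add: power2_eq_square algebra_simps)
    then show ?thesis using t unfolding M_def t_def by (smt (verit) zero_le_power2)
  qed
  have "Cauchy X"
  proof (rule CauchyI)
    fix e :: real assume "0 < e"
    then have "0 < e / 2" by simp
    from uniformly_convex_midpoint[OF uc this, of M] obtain d where d: "0 < d"
      and close: "\<And>x y::'a. \<lbrakk>norm x \<le> M; norm y \<le> M;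
         2 * (norm x)\<^sup>2 + 2 * (norm y)\<^sup>2 - (norm (x + y))\<^sup>2 \<le> d\<rbrakk> \<Longrightarrow> norm (x - y) \<le> e / 2" by metis
    obtain n0 where n0: "1 / (real n0 + 1) < d / 4"
      using d reals_Archimedean[of "d / 4"] by (auto simp: inverse_eq_divide add.commute)
    have near: "h (X n) < m + d / 4" if "n0 \<le> n" for n
    proof -
      have "1 / (real n + 1) \<le> 1 / (real n0 + 1)" using that by (simp add: field_simps)
      then show ?thesis using X(2)[of n] n0 by linarith
    qed
    have "norm (X i - X j) < e" if "n0 \<le> i" "n0 \<le> j" for i j
    proof -
      define z where "z = (1/2) *\<^sub>R X i + (1/2) *\<^sub>R X j"
      have "z \<in> K" unfolding z_def using X(1) K(2) by (intro convexD) auto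
      moreover have "4 * h z = (norm (X i + X j))\<^sup>2 - 4 * (l (X i) + l (X j))"
      proof -
        have "z = (1/2) *\<^sub>R (X i + X j)" by (simp add: z_def scaleR_right_distrib)
        then have half: "norm z = norm (X i + X j) / 2" "l z = (l (X i) + l (X j)) / 2"
          by (simp_all only: l.scaleR l.add) simp_all
        show ?thesis unfolding h_def half power_divide by (simp add: field_simps)
      qed
      ultimately have "4 * m \<le> (norm (X i + X j))\<^sup>2 - 4 * (l (X i) + l (X j))" using m[of z] by simp
      then have "2 * (norm (X i))\<^sup>2 + 2 * (norm (X j))\<^sup>2 - (norm (X i + X j))\<^sup>2 \<le> d"
        using near[OF that(1)] near[OF that(2)] unfolding h_def by argo
      then have "norm (X i - X j) \<le> e / 2" by (intro close bounded)
      then show ?thesis using \<open>0 < e\<close> by simp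
    qed
    then show "\<exists>M. \<forall>m\<ge>M. \<forall>n\<ge>M. norm (X m - X n) < e" by blast
  qed
  then obtain x where lim: "X \<longlonglongrightarrow> x" using Cauchy_convergent convergent_def by blast
  have "x \<in> K" using K(1) X(1) lim by (metis closed_sequentially)
  moreover have "h x \<le> m"
  proof (rule LIMSEQ_le)
    show "(\<lambda>n. h (X n)) \<longlonglongrightarrow> h x" unfolding h_def by (intro tendsto_intros lim l.tendsto)
    show "(\<lambda>n. m + 1 / (real n + 1)) \<longlonglongrightarrow> m"
      using tendsto_add[OF tendsto_const[of m] LIMSEQ_inverse_real_of_nat]
      by (simp add: inverse_eq_divide add.commute)
    show "\<exists>N. \<forall>n\<ge>N. h (X n) \<le> m + 1 / (real n + 1)" using X(2) less_imp_le by blast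
  qed
  ultimately show thesis using that m unfolding h_def by (meson order_trans)
qed

text \<open>
  From \<open>V (2 f) (x + y) \<ge> 0\<close> one gets
  \<open>2 \<parallel>x\<parallel>\<^sup>2 + 2 \<parallel>y\<parallel>\<^sup>2 - \<parallel>x + y\<parallel>\<^sup>2 \<le> 2 V f x + 2 V f y\<close>. The bound on \<open>f\<close> also bounds \<open>x\<close> and \<open>y\<close>,
  since \<open>V f x \<ge> (\<parallel>f\<parallel> - \<parallel>x\<parallel>)\<^sup>2\<close>.
\<close>
lemma vectors_close:
  fixes M e :: real
  assumes "uniformly_convex TYPE('a::real_normed_vector)" "0 < e"
  obtains d where "0 < d"
    "\<And>f (x::'a) y. \<lbrakk>norm f \<le> M; alber f x \<le> d; alber f y \<le> d\<rbrakk> \<Longrightarrow> norm (x - y) \<le> e"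
proof -
  from uniformly_convex_midpoint[OF assms, of "M + 1"] obtain d where d: "0 < d"
    and close: "\<And>x y::'a. \<lbrakk>norm x \<le> M + 1; norm y \<le> M + 1;
         2 * (norm x)\<^sup>2 + 2 * (norm y)\<^sup>2 - (norm (x + y))\<^sup>2 \<le> d\<rbrakk> \<Longrightarrow> norm (x - y) \<le> e" by metis
  define r where "r = min 1 (d / 4)"
  have r: "0 < r" "r \<le> 1" "4 * r \<le> d" using d by (auto simp: r_def)
  show thesis
  proof (rule that[OF r(1)])
    fix f :: "'a \<Rightarrow>\<^sub>L real" and x y :: 'a
    assume f: "norm f \<le> M" and V: "alber f x \<le> r" "alber f y \<le> r"
    have bound: "norm z \<le> M + 1" if "alber f z \<le> r" for z
    proof -
      have "(norm z - norm f)\<^sup>2 \<le> 1\<^sup>2" using alber_ge[of f z] that r by (simp add: power2_commute)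
      then have "norm z - norm f \<le> 1" by (rule power2_le_imp_le) simp
      then show ?thesis using f by simp
    qed
    have "2 * (norm x)\<^sup>2 + 2 * (norm y)\<^sup>2 - (norm (x + y))\<^sup>2 \<le> d"
    proof -
      have "0 \<le> alber (2 *\<^sub>R f) (x + y)" by (rule alber_nonneg)
      then show ?thesis using V r
        by (simp add: alber_def blinfun.bilinear_simps power_mult_distrib)
    qed
    then show "norm (x - y) \<le> e" by (intro close bound V)
  qed
qed

section \<open>The duality map and sunny retractions\<close>

definition dmap :: "'a::real_normed_vector \<Rightarrow> ('a \<Rightarrow>\<^sub>L real)" where
  "dmap x = (THE f. f \<in> duality_map x)"

text \<open>
  A preimage is used instead of the image of \<open>D\<close>, so that intersections are immediate even before
  \<open>dmap\<close> is known to be bijective.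
\<close>
definition dual_convex :: "'a::real_normed_vector set \<Rightarrow> bool" where
  "dual_convex D \<longleftrightarrow> (\<exists>K. closed K \<and> convex K \<and> D = dmap -` K)"

lemma dual_convex_UNIV: "dual_convex UNIV"
  unfolding dual_convex_def by (rule exI[of _ UNIV]) auto

lemma dual_convex_Inter:
  assumes "\<And>i. i \<in> I \<Longrightarrow> dual_convex (D i)"
  shows "dual_convex (\<Inter>i\<in>I. D i)"
proof -
  from assms obtain K where K: "\<And>i. i \<in> I \<Longrightarrow> closed (K i) \<and> convex (K i) \<and> D i = dmap -` K i"
    unfolding dual_convex_def by metis
  show ?thesis unfolding dual_convex_def
    by (rule exI[of _ "\<Inter>i\<in>I. K i"]) (use K in \<open>auto intro!: convex_INT\<close>)
qed

lemma dual_convex_Int: "dual_convex D \<Longrightarrow> dual_convex E \<Longrightarrow> dual_convex (D \<inter> E)"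
  unfolding dual_convex_def by (metis closed_Int convex_Int vimage_Int)

context
  assumes smooth: "uniformly_smooth TYPE('a::banach)"
begin

lemma dmap_in_duality_map: "dmap x \<in> duality_map (x::'a)"
  unfolding dmap_def by (rule theI') (rule duality_map_singleton[OF smooth])

lemma dmap_eqI: "f \<in> duality_map (x::'a) \<Longrightarrow> dmap x = f"
  using duality_map_singleton[OF smooth] dmap_in_duality_map by blast

lemma norm_dmap: "norm (dmap x) = norm (x::'a)"
  using dmap_in_duality_map[of x] by (simp add: duality_map_def)

lemma dmap_self: "blinfun_apply (dmap x) (x::'a) = (norm x)\<^sup>2"
  using dmap_in_duality_map[of x] by (simp add: duality_map_def)

lemma alber_dmap_self: "alber (dmap x) (x::'a) = 0"
  by (simp add: alber_eq_0_iff dmap_in_duality_map)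

lemma phi_eq_alber: "phi x (y::'a) = alber (dmap y) x"
  by (simp add: phi_def alber_def norm_dmap flip: dmap_def)

lemma phi_nonneg: "0 \<le> phi x (y::'a)"
  by (simp add: phi_eq_alber alber_nonneg)

text \<open>
  Both \<open>J x\<close> and \<open>J (g i)\<close> have small \<open>V\<close> at the vector \<open>g i\<close>.
\<close>
lemma tendsto_dmap:
  fixes g :: "'b \<Rightarrow> 'a"
  assumes "(g \<longlongrightarrow> x) F"
  shows "((\<lambda>i. dmap (g i)) \<longlongrightarrow> dmap x) F"
proof (rule tendstoI)
  fix e :: real assume "0 < e"
  then have e: "0 < e / 2" by simp
  from functionals_close[OF smooth e, of "norm x + 1"] obtain d where d: "0 < d"
    and close: "\<And>(z::'a) f g. \<lbrakk>norm z \<le> norm x + 1; alber f z + alber g z \<le> d\<rbrakk> \<Longrightarrow> norm (f - g) \<le> e / 2"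
    by metis
  have "((\<lambda>i. alber (dmap x) (g i)) \<longlongrightarrow> alber (dmap x) x) F"
    unfolding alber_def by (intro tendsto_intros assms)
  then have "\<forall>\<^sub>F i in F. alber (dmap x) (g i) < d"
    using d by (intro order_tendstoD) (auto simp: alber_dmap_self)
  moreover have "\<forall>\<^sub>F i in F. norm (g i) < norm x + 1"
    by (intro order_tendstoD(2)[OF tendsto_norm[OF assms]]) simp
  ultimately show "\<forall>\<^sub>F i in F. dist (dmap (g i)) (dmap x) < e"
  proof eventually_elim
    case (elim i)
    then have "norm (dmap (g i) - dmap x) \<le> e / 2"
      by (intro close[of "g i"]) (auto simp: alber_dmap_self)
    then show ?case using \<open>0 < e\<close> by (simp add: dist_norm)
  qed
qed

lemma tendsto_phi:
  fixes g h :: "'b \<Rightarrow> 'a"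
  assumes "(g \<longlongrightarrow> a) F" "(h \<longlongrightarrow> b) F"
  shows "((\<lambda>i. phi (g i) (h i)) \<longlongrightarrow> phi a b) F"
  unfolding phi_eq_alber alber_def by (intro tendsto_intros tendsto_dmap assms)

lemma closed_dual_convex:
  assumes "dual_convex (D::'a set)"
  shows "closed D"
proof -
  have "continuous_on UNIV (dmap :: 'a \<Rightarrow> _)"
    unfolding continuous_on_def by (intro ballI tendsto_dmap tendsto_ident_at)
  then show ?thesis using assms unfolding dual_convex_def by (auto intro: closed_vimage)
qed

text \<open>
  The terms quadratic in \<open>z\<close> cancel, and what is left is a closed half-space in \<open>J z\<close>.
\<close>
lemma dual_convex_phi_le: "dual_convex {z::'a. phi a z \<le> phi b z + c}"
proof -
  let ?t = "((norm a)\<^sup>2 - (norm b)\<^sup>2 - c) / 2"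
  let ?K = "{f::'a \<Rightarrow>\<^sub>L real. ?t \<le> blinfun_apply f (a - b)}"
  have "closed ?K" by (intro closed_Collect_le continuous_intros)
  moreover have "convex ?K"
  proof (rule convexI)
    fix f g :: "'a \<Rightarrow>\<^sub>L real" and s r :: real
    assume *: "f \<in> ?K" "g \<in> ?K" "0 \<le> s" "0 \<le> r" "s + r = 1"
    have "?t = s * ?t + r * ?t" using *(5) by (metis distrib_right mult_1)
    also have "\<dots> \<le> s * blinfun_apply f (a - b) + r * blinfun_apply g (a - b)"
      using * by (intro add_mono mult_left_mono) auto
    finally show "s *\<^sub>R f + r *\<^sub>R g \<in> ?K" by (simp add: blinfun.add_left blinfun.scaleR_left)
  qed
  moreover have "{z. phi a z \<le> phi b z + c} = dmap -` ?K"
    by (auto simp: phi_eq_alber alber_def blinfun.diff_right)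
  ultimately show ?thesis unfolding dual_convex_def by blast
qed

text \<open>
  The law of cosines for \<open>\<phi>\<close>.
\<close>
lemma phi_three_point:
  "phi x p = phi (z::'a) p + phi x z + 2 * blinfun_apply (dmap z - dmap p) (x - z)"
  by (simp add: phi_eq_alber alber_def norm_dmap dmap_self blinfun.bilinear_simps)

text \<open>
  Half of the squared norm is convex with gradient \<open>J\<close>. The gradient inequality at \<open>z + t u\<close> and
  continuity of \<open>J\<close> take the place of a differentiation at \<open>z\<close>.
\<close>
lemma dmap_one_sided_derivative:
  fixes z u :: 'a
  assumes "\<And>t. 0 < t \<Longrightarrow> 2 * t * c \<le> (norm (z + t *\<^sub>R u))\<^sup>2 - (norm z)\<^sup>2"
  shows "c \<le> blinfun_apply (dmap z) u"
proof (rule tendsto_lowerbound)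
  have "((\<lambda>t. z + t *\<^sub>R u) \<longlongrightarrow> z + 0 *\<^sub>R u) (at_right 0)" by (intro tendsto_intros)
  then have "((\<lambda>t. dmap (z + t *\<^sub>R u)) \<longlongrightarrow> dmap z) (at_right 0)" by (intro tendsto_dmap) simp
  then show "((\<lambda>t. blinfun_apply (dmap (z + t *\<^sub>R u)) u) \<longlongrightarrow> blinfun_apply (dmap z) u) (at_right 0)"
    by (intro tendsto_intros)
  show "\<forall>\<^sub>F t in at_right 0. c \<le> blinfun_apply (dmap (z + t *\<^sub>R u)) u"
    unfolding eventually_at_right_field
  proof (intro exI[of _ 1] conjI allI impI)
    fix t :: real assume t: "0 < t"
    define x where "x = z + t *\<^sub>R u"
    have "z = x - t *\<^sub>R u" by (simp add: x_def)
    then have "blinfun_apply (dmap x) z = (norm x)\<^sup>2 - t * blinfun_apply (dmap x) u"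
      by (simp add: blinfun.diff_right blinfun.scaleR_right dmap_self)
    then have "(norm x)\<^sup>2 - (norm z)\<^sup>2 \<le> 2 * t * blinfun_apply (dmap x) u"
      using alber_nonneg[of "dmap x" z] by (simp add: alber_def norm_dmap)
    then have "2 * t * c \<le> 2 * t * blinfun_apply (dmap x) u"
      using assms[OF t] by (simp add: x_def)
    then show "c \<le> blinfun_apply (dmap (z + t *\<^sub>R u)) u" using t by (simp add: x_def)
  qed simp
qed simp

text \<open>
  Sunniness sends the whole ray from \<open>R x\<close> through \<open>x\<close> to \<open>R x\<close>. The inequality
  \<open>\<phi> (R x) p \<le> \<phi> x' p\<close> along this ray, differentiated at its origin, is the variational inequality.
\<close>
lemma sunny_variational:
  fixes D :: "'a set"
  assumes R: "sunny_gn_retraction R D" and p: "p \<in> D"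
  shows "0 \<le> blinfun_apply (dmap (R x) - dmap p) (x - R x)"
proof -
  have "blinfun_apply (dmap p) (x - R x) \<le> blinfun_apply (dmap (R x)) (x - R x)"
  proof (rule dmap_one_sided_derivative)
    fix t :: real assume "0 < t"
    then have "R (R x + t *\<^sub>R (x - R x)) = R x" using R unfolding sunny_gn_retraction_def by auto
    then have "phi (R x) p \<le> phi (R x + t *\<^sub>R (x - R x)) p"
      using R p unfolding sunny_gn_retraction_def by metis
    then show "2 * t * blinfun_apply (dmap p) (x - R x) \<le> (norm (R x + t *\<^sub>R (x - R x)))\<^sup>2 - (norm (R x))\<^sup>2"
      by (simp add: phi_eq_alber alber_def blinfun.add_right blinfun.scaleR_right)
  qed
  then show ?thesis by (simp add: blinfun.diff_left)
qed

lemma sunny_phi_le: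
  fixes D :: "'a set"
  assumes "sunny_gn_retraction R D" "p \<in> D"
  shows "phi (R x) p + phi x (R x) \<le> phi x p"
  using sunny_variational[OF assms, of x] phi_three_point[of x p "R x"] by simp

context
  assumes convex: "uniformly_convex TYPE('a)"
begin

text \<open>
  The mirror image of \<open>tendsto_dmap\<close>: both \<open>x\<close> and \<open>g i\<close> have small \<open>V\<close> against the functional
  \<open>J (g i)\<close>.
\<close>
lemma tendsto_dmapD:
  fixes g :: "'b \<Rightarrow> 'a"
  assumes "((\<lambda>i. dmap (g i)) \<longlongrightarrow> dmap x) F"
  shows "(g \<longlongrightarrow> x) F"
proof (rule tendstoI)
  fix e :: real assume "0 < e"
  then have e: "0 < e / 2" by simp
  from vectors_close[OF convex e, of "norm x + 1"] obtain d where d: "0 < d"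
    and close: "\<And>f (x'::'a) y. \<lbrakk>norm f \<le> norm x + 1; alber f x' \<le> d; alber f y \<le> d\<rbrakk> \<Longrightarrow> norm (x' - y) \<le> e / 2"
    by metis
  have "((\<lambda>i. alber (dmap (g i)) x) \<longlongrightarrow> alber (dmap x) x) F"
    unfolding alber_def by (intro tendsto_intros assms)
  then have "\<forall>\<^sub>F i in F. alber (dmap (g i)) x < d"
    using d by (intro order_tendstoD) (auto simp: alber_dmap_self)
  moreover have "\<forall>\<^sub>F i in F. norm (dmap (g i)) < norm x + 1"
    by (intro order_tendstoD(2)[OF tendsto_norm[OF assms]]) (simp add: norm_dmap)
  ultimately show "\<forall>\<^sub>F i in F. dist (g i) x < e"
  proof eventually_elim
    case (elim i)
    then have "norm (g i - x) \<le> e / 2"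
      using d by (intro close[of "dmap (g i)"]) (auto simp: alber_dmap_self)
    then show ?case using \<open>0 < e\<close> by (simp add: dist_norm)
  qed
qed

lemma inj_dmap:
  assumes "dmap x = dmap (y::'a)"
  shows "x = y"
proof -
  have "((\<lambda>i::nat. y) \<longlongrightarrow> x) sequentially" by (rule tendsto_dmapD) (simp add: assms)
  then show ?thesis by (simp add: LIMSEQ_const_iff)
qed

lemma phi_eq_0_iff: "phi x (y::'a) = 0 \<longleftrightarrow> x = y"
proof
  assume "phi x y = 0"
  then have "dmap y \<in> duality_map x" by (simp add: phi_eq_alber alber_eq_0_iff)
  then show "x = y" using dmap_eqI inj_dmap by blast
qed (simp add: phi_eq_alber alber_dmap_self)

text \<open>
  The minimizer \<open>x\<close> of \<open>\<parallel>x\<parallel>\<^sup>2 - 2 f x\<close> satisfies \<open>J x = f\<close>. Instead of differentiating, variations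
  of \<open>x\<close> in an arbitrary direction bound the norm of \<open>f\<close>, and shrinking \<open>x\<close> bounds \<open>f x\<close> from
  below; the two bounds leave no room for \<open>V f x > 0\<close>.
\<close>
lemma surj_dmap: "\<exists>x::'a. dmap x = f"
proof -
  obtain x where min: "\<And>y::'a. (norm x)\<^sup>2 - 2 * blinfun_apply f x \<le> (norm y)\<^sup>2 - 2 * blinfun_apply f y"
    using quadratic_attains_min[OF convex blinfun.bounded_linear_right[of f], of UNIV] by auto
  have upper: "blinfun_apply f y \<le> norm x * norm y" for y
  proof (rule tendsto_lowerbound)
    have "((\<lambda>t. norm x * norm y + t * (norm y)\<^sup>2 / 2) \<longlongrightarrow> norm x * norm y + 0 * (norm y)\<^sup>2 / 2) (at_right 0)"
      by (intro tendsto_intros) simp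
    then show "((\<lambda>t. norm x * norm y + t * (norm y)\<^sup>2 / 2) \<longlongrightarrow> norm x * norm y) (at_right 0)" by simp
    show "\<forall>\<^sub>F t in at_right 0. blinfun_apply f y \<le> norm x * norm y + t * (norm y)\<^sup>2 / 2"
      unfolding eventually_at_right_field
    proof (intro exI[of _ 1] conjI allI impI)
      fix t :: real assume t: "0 < t"
      have "(norm (x + t *\<^sub>R y))\<^sup>2 \<le> (norm x + t * norm y)\<^sup>2"
        using norm_triangle_ineq[of x "t *\<^sub>R y"] t by (intro power_mono) auto
      then have "2 * t * blinfun_apply f y \<le> 2 * t * (norm x * norm y + t * (norm y)\<^sup>2 / 2)"
        using min[of "x + t *\<^sub>R y"]
        by (simp add: blinfun.add_right blinfun.scaleR_right power2_eq_square algebra_simps)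
      then show "blinfun_apply f y \<le> norm x * norm y + t * (norm y)\<^sup>2 / 2" using t by simp
    qed simp
  qed simp
  have "norm f \<le> norm x"
    by (rule norm_blinfun_bound)
      (use upper upper[of "- _"] in \<open>auto simp: abs_le_iff blinfun.minus_right\<close>)
  moreover have "(norm x)\<^sup>2 \<le> blinfun_apply f x"
  proof (rule tendsto_upperbound)
    have "((\<lambda>t. (1 - t / 2) * (norm x)\<^sup>2) \<longlongrightarrow> (1 - 0 / 2) * (norm x)\<^sup>2) (at_right 0)"
      by (intro tendsto_intros) simp
    then show "((\<lambda>t. (1 - t / 2) * (norm x)\<^sup>2) \<longlongrightarrow> (norm x)\<^sup>2) (at_right 0)" by simp
    show "\<forall>\<^sub>F t in at_right 0. (1 - t / 2) * (norm x)\<^sup>2 \<le> blinfun_apply f x"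
      unfolding eventually_at_right_field
    proof (intro exI[of _ 1] conjI allI impI)
      fix t :: real assume t: "0 < t"
      define y where "y = (1 - t) *\<^sub>R x"
      have "(norm y)\<^sup>2 = (1 - t)\<^sup>2 * (norm x)\<^sup>2" "blinfun_apply f y = (1 - t) * blinfun_apply f x"
        by (simp_all add: y_def power_mult_distrib blinfun.scaleR_right)
      then have "2 * t * ((1 - t / 2) * (norm x)\<^sup>2) \<le> 2 * t * blinfun_apply f x"
        using min[of y] by (simp add: power2_eq_square algebra_simps)
      then show "(1 - t / 2) * (norm x)\<^sup>2 \<le> blinfun_apply f x" using t by simp
    qed simp
  qed simp
  moreover have "(norm f)\<^sup>2 \<le> (norm x)\<^sup>2" using \<open>norm f \<le> norm x\<close> by (intro power_mono) auto
  ultimately have "alber f x \<le> 0" unfolding alber_def by linarith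
  then have "alber f x = 0" using alber_nonneg[of f x] by simp
  then have "dmap x = f" by (simp add: alber_eq_0_iff dmap_eqI)
  then show ?thesis by blast
qed

lemma sunny_unique:
  fixes D :: "'a set"
  assumes R: "sunny_gn_retraction R D" and z: "z \<in> D" "\<And>p. p \<in> D \<Longrightarrow> phi x z \<le> phi x p"
  shows "R x = z"
proof -
  have "R x \<in> D" using R unfolding sunny_gn_retraction_def by blast
  then have "phi (R x) z \<le> 0" using sunny_phi_le[OF R z(1), of x] z(2)[of "R x"] by simp
  then show ?thesis using phi_nonneg[of "R x" z] phi_eq_0_iff by (meson antisym)
qed

text \<open>
  The first-order condition at the minimizer \<open>f = J z\<close> of \<open>\<parallel>g\<parallel>\<^sup>2 - 2 g x\<close> over the closed convex
  set of functionals: half of the squared dual norm has gradient \<open>J\<^sup>-\<^sup>1\<close>, so moving from \<open>f\<close>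
  towards \<open>J p\<close> changes the functional at the rate \<open>2 (J p - J z) (z - x)\<close>, which is nonnegative.
\<close>
lemma variational_solution:
  fixes D :: "'a set"
  assumes "dual_convex D" "D \<noteq> {}"
  obtains z where "z \<in> D" "\<And>p. p \<in> D \<Longrightarrow> 0 \<le> blinfun_apply (dmap z - dmap p) (x - z)"
proof -
  from assms(1) obtain K where K: "closed K" "convex K" and D: "D = dmap -` K"
    unfolding dual_convex_def by blast
  have "K \<noteq> {}" using assms(2) D by auto
  from quadratic_attains_min[OF dual_uniformly_convex[OF smooth] blinfun.bounded_linear_left[of x] K this]
  obtain f where f: "f \<in> K" and min: "\<And>g. g \<in> K \<Longrightarrow>
      (norm f)\<^sup>2 - 2 * blinfun_apply f x \<le> (norm g)\<^sup>2 - 2 * blinfun_apply g x" by metis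
  obtain z where z: "dmap z = f" using surj_dmap by blast
  show thesis
  proof (rule that)
    show "z \<in> D" using f z D by simp
    fix p assume "p \<in> D"
    then have p: "dmap p \<in> K" using D by simp
    have "\<forall>s. \<exists>y. dmap y = (1 - s) *\<^sub>R f + s *\<^sub>R dmap p" using surj_dmap by blast
    from choice[OF this] obtain r where r: "\<And>s. dmap (r s) = (1 - s) *\<^sub>R f + s *\<^sub>R dmap p" by blast
    have lim_r: "(r \<longlongrightarrow> z) (at_right 0)"
    proof (rule tendsto_dmapD)
      have "((\<lambda>s. (1 - s) *\<^sub>R f + s *\<^sub>R dmap p) \<longlongrightarrow> (1 - 0) *\<^sub>R f + 0 *\<^sub>R dmap p) (at_right 0)"
        by (intro tendsto_intros)
      then show "((\<lambda>s. dmap (r s)) \<longlongrightarrow> dmap z) (at_right 0)" by (simp add: r z)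
    qed
    have "blinfun_apply (dmap p - f) (x - z) \<le> 0"
    proof (rule tendsto_upperbound)
      show "((\<lambda>s. blinfun_apply (dmap p - f) (x - r s)) \<longlongrightarrow> blinfun_apply (dmap p - f) (x - z)) (at_right 0)"
        by (intro tendsto_intros lim_r)
      show "\<forall>\<^sub>F s in at_right 0. blinfun_apply (dmap p - f) (x - r s) \<le> 0"
        unfolding eventually_at_right_field
      proof (intro exI[of _ 1] conjI allI impI)
        fix s :: real assume s: "0 < s" "s < 1"
        \<comment> \<open>Minimality of \<open>f\<close> against the gradient inequality of the squared dual norm at
          \<open>g\<close>, in the form \<open>V f (r s) \<ge> 0\<close>.\<close>
        define g where "g = dmap (r s)"
        have "g \<in> K" unfolding g_def r using K(2) f p s by (intro convexD) auto
        then have "(norm f)\<^sup>2 - 2 * blinfun_apply f x \<le> (norm g)\<^sup>2 - 2 * blinfun_apply g x" by (rule min)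
        moreover have "0 \<le> alber f (r s)" by (rule alber_nonneg)
        moreover have "norm g = norm (r s)" "blinfun_apply g (r s) = (norm (r s))\<^sup>2"
          by (simp_all add: g_def norm_dmap dmap_self)
        ultimately have "blinfun_apply (g - f) (x - r s) \<le> 0"
          by (simp add: alber_def blinfun.bilinear_simps)
        moreover have "g - f = s *\<^sub>R (dmap p - f)" by (simp add: g_def r algebra_simps)
        ultimately show "blinfun_apply (dmap p - f) (x - r s) \<le> 0"
          using s by (simp add: blinfun.scaleR_left mult_le_0_iff)
      qed simp
    qed simp
    then show "0 \<le> blinfun_apply (dmap z - dmap p) (x - z)" by (simp add: z blinfun.diff_left)
  qed
qed

text \<open>
  The variational inequality at \<open>x\<close> with solution \<open>z\<close> is also the one at any other point of the
  ray from \<open>z\<close> through \<open>x\<close>, which is why the solution map is sunny.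
\<close>
theorem ex1_sunny_gn_retraction:
  fixes D :: "'a set"
  assumes D: "dual_convex D" "D \<noteq> {}"
  shows "\<exists>!R. sunny_gn_retraction R D"
proof (rule ex_ex1I)
  have "\<exists>z\<in>D. \<forall>p\<in>D. 0 \<le> blinfun_apply (dmap z - dmap p) (x - z)" for x
    using variational_solution[OF D, of x] by metis
  then obtain R where RD: "\<And>x. R x \<in> D"
    and var: "\<And>x p. p \<in> D \<Longrightarrow> 0 \<le> blinfun_apply (dmap (R x) - dmap p) (x - R x)" by metis
  have le: "phi (R x) p + phi x (R x) \<le> phi x p" if "p \<in> D" for x p
    using var[OF that, of x] phi_three_point[of x p "R x"] by simp
  have solution_unique: "R x = z"
    if z: "z \<in> D" "\<And>p. p \<in> D \<Longrightarrow> 0 \<le> blinfun_apply (dmap z - dmap p) (x - z)" for x z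
  proof -
    have "phi z (R x) + phi x z \<le> phi x (R x)"
      using z(2)[OF RD, of x] phi_three_point[of x "R x" z] by simp
    then have "phi z (R x) \<le> 0" using le[OF z(1), of x] phi_nonneg[of "R x" z] by simp
    then show ?thesis using phi_nonneg[of z "R x"] phi_eq_0_iff by (metis antisym)
  qed
  have "sunny_gn_retraction R D"
    unfolding sunny_gn_retraction_def
  proof (intro conjI ballI allI impI)
    show fixed: "R z = z" if "z \<in> D" for z using that by (intro solution_unique) auto
    show "range R = D"
    proof
      show "D \<subseteq> range R" using fixed by (metis rangeI subsetI)
    qed (use RD in blast)
    show "R (R x + t *\<^sub>R (x - R x)) = R x" if "0 \<le> t" for x t
    proof (rule solution_unique[OF RD])
      fix p assume "p \<in> D"
      have "R x + t *\<^sub>R (x - R x) - R x = t *\<^sub>R (x - R x)" by simp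
      then show "0 \<le> blinfun_apply (dmap (R x) - dmap p) (R x + t *\<^sub>R (x - R x) - R x)"
        using var[OF \<open>p \<in> D\<close>, of x] that by (simp only: blinfun.scaleR_right) simp
    qed
    show "phi (R x) p \<le> phi x p" if "p \<in> D" for x p
      using le[OF that, of x] phi_nonneg[of x "R x"] by simp
  qed
  then show "\<exists>R. sunny_gn_retraction R D" by blast
next
  fix R R' assume R: "sunny_gn_retraction R D" and R': "sunny_gn_retraction R' D"
  show "R = R'"
  proof
    fix x
    show "R x = R' x"
    proof (rule sunny_unique[OF R])
      show "R' x \<in> D" using R' unfolding sunny_gn_retraction_def by blast
      show "phi x (R' x) \<le> phi x p" if "p \<in> D" for p
        using sunny_phi_le[OF R' that, of x] phi_nonneg[of "R' x" p] by simp
    qed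
  qed
qed

lemma sunny_sgn_retraction:
  fixes D :: "'a set"
  assumes "dual_convex D" "D \<noteq> {}"
  shows "sunny_gn_retraction (sgn_retraction D) D"
  unfolding sgn_retraction_def by (rule theI'[OF ex1_sunny_gn_retraction[OF assms]])

text \<open>
  A point \<open>z\<close> with \<open>\<phi> (S x) z \<le> \<phi> x z\<close> for all \<open>x\<close> is fixed, because \<open>x = z\<close> gives
  \<open>\<phi> (S z) z \<le> 0\<close>. This presents the fixed point set as an intersection of half-spaces in \<open>J z\<close>.
\<close>
lemma dual_convex_Fix:
  fixes S :: "'a \<Rightarrow> 'a"
  assumes "generalized_nonexpansive S"
  shows "dual_convex (Fix S)"
proof -
  have eq: "Fix S = (\<Inter>x. {z. phi (S x) z \<le> phi x z + 0})"
  proof (intro equalityI subsetI)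
    fix z assume "z \<in> Fix S"
    then show "z \<in> (\<Inter>x. {z. phi (S x) z \<le> phi x z + 0})"
      using assms unfolding generalized_nonexpansive_def by auto
  next
    fix z assume "z \<in> (\<Inter>x. {z. phi (S x) z \<le> phi x z + 0})"
    then have "phi (S z) z \<le> phi z z" by auto
    then have "phi (S z) z = 0" using phi_nonneg[of "S z" z] phi_eq_0_iff[of z z] by simp
    then show "z \<in> Fix S" by (simp add: Fix_def phi_eq_0_iff)
  qed
  show ?thesis unfolding eq by (intro dual_convex_Inter dual_convex_phi_le)
qed

end
end

section \<open>The shrinking iteration\<close>

text \<open>
  The recursion for \<open>v\<close> reaches back two steps, so stage \<open>n\<close> carries \<open>v n\<close>, \<open>v (n + 1)\<close> and
  \<open>C (n + 1)\<close>.
\<close>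
primrec shrinking_state ::
    "(nat \<Rightarrow> 'a::real_normed_vector \<Rightarrow> 'a) \<Rightarrow> (nat \<Rightarrow> real) \<Rightarrow> (nat \<Rightarrow> real) \<Rightarrow> (nat \<Rightarrow> real) \<Rightarrow> 'a \<Rightarrow>
     nat \<Rightarrow> 'a \<times> 'a \<times> 'a set" where
  "shrinking_state T \<alpha> \<beta> \<epsilon> v0 0 = (v0, v0, UNIV)"
| "shrinking_state T \<alpha> \<beta> \<epsilon> v0 (Suc n) =
     (let (v', v, C) = shrinking_state T \<alpha> \<beta> \<epsilon> v0 n; k = Suc n;
          w = v + \<beta> k *\<^sub>R (v - v');
          y = \<alpha> k *\<^sub>R w + (1 - \<alpha> k) *\<^sub>R T k w;
          C' = {u \<in> C. phi y u \<le> phi w u + (1 - \<alpha> k) * \<epsilon> k}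
      in (v, sgn_retraction C' v0, C'))"

lemma shrinking_iteration_exists: "\<exists>v w y C. shrinking_iteration T \<alpha> \<beta> \<epsilon> v0 v w y C"
proof -
  define st where "st = shrinking_state T \<alpha> \<beta> \<epsilon> v0"
  define v where "v = (\<lambda>k. fst (st k))"
  define C where "C = (\<lambda>k. snd (snd (st (k - 1))))"
  define w where "w = (\<lambda>k. v k + \<beta> k *\<^sub>R (v k - v (k - 1)))"
  define y where "y = (\<lambda>k. \<alpha> k *\<^sub>R w k + (1 - \<alpha> k) *\<^sub>R T k (w k))"
  have st: "st n = (v n, v (Suc n), C (Suc n))" for n
    by (auto simp: v_def C_def st_def Let_def split: prod.splits)
  have "st (Suc n) = (v (Suc n),
      sgn_retraction {u \<in> C (Suc n). phi (y (Suc n)) u \<le> phi (w (Suc n)) u + (1 - \<alpha> (Suc n)) * \<epsilon> (Suc n)} v0,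
      {u \<in> C (Suc n). phi (y (Suc n)) u \<le> phi (w (Suc n)) u + (1 - \<alpha> (Suc n)) * \<epsilon> (Suc n)})" for n
    using st[of n] unfolding st_def by (simp add: Let_def w_def y_def)
  then have step: "C (Suc (Suc n)) = {u \<in> C (Suc n). phi (y (Suc n)) u \<le> phi (w (Suc n)) u + (1 - \<alpha> (Suc n)) * \<epsilon> (Suc n)}"
      "v (Suc (Suc n)) = sgn_retraction (C (Suc (Suc n))) v0" for n
    using st[of "Suc n"] by auto
  have "shrinking_iteration T \<alpha> \<beta> \<epsilon> v0 v w y C"
    unfolding shrinking_iteration_def
  proof (intro conjI allI impI)
    have "st 0 = (v0, v0, UNIV)" by (simp add: st_def)
    then show "v 0 = v0" "v 1 = v0" "C 1 = UNIV" using st[of 0] by auto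
    fix k :: nat assume "1 \<le> k"
    then obtain n where k: "k = Suc n" by (cases k) auto
    show "w k = v k + \<beta> k *\<^sub>R (v k - v (k - 1))" by (simp add: w_def)
    show "y k = \<alpha> k *\<^sub>R w k + (1 - \<alpha> k) *\<^sub>R T k (w k)" by (simp add: y_def)
    show "C (k + 1) = {u \<in> C k. phi (y k) u \<le> phi (w k) u + (1 - \<alpha> k) * \<epsilon> k}"
      using step(1)[of n] by (simp add: k)
    show "v (k + 1) = sgn_retraction (C (k + 1)) v0" using step(2)[of n] by (simp add: k)
  qed
  then show ?thesis by blast
qed

lemma norm_square_convex_combination:
  fixes x y :: "'a::real_normed_vector"
  assumes "0 \<le> a" "a \<le> 1"
  shows "(norm (a *\<^sub>R x + (1 - a) *\<^sub>R y))\<^sup>2 \<le> a * (norm x)\<^sup>2 + (1 - a) * (norm y)\<^sup>2"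
proof -
  have "norm (a *\<^sub>R x + (1 - a) *\<^sub>R y) \<le> a * norm x + (1 - a) * norm y"
    using norm_triangle_ineq[of "a *\<^sub>R x" "(1 - a) *\<^sub>R y"] assms by simp
  then have "(norm (a *\<^sub>R x + (1 - a) *\<^sub>R y))\<^sup>2 \<le> (a * norm x + (1 - a) * norm y)\<^sup>2"
    by (intro power_mono) auto
  moreover have "0 \<le> a * (1 - a) * (norm x - norm y)\<^sup>2" using assms by simp
  ultimately show ?thesis by (simp add: power2_eq_square algebra_simps)
qed

lemma phi_convex_combination:
  assumes "0 \<le> a" "a \<le> 1"
  shows "phi (a *\<^sub>R x + (1 - a) *\<^sub>R y) z \<le> a * phi x z + (1 - a) * phi y z"
proof -
  define w where "w = a *\<^sub>R x + (1 - a) *\<^sub>R y"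
  have "(norm w)\<^sup>2 \<le> a * (norm x)\<^sup>2 + (1 - a) * (norm y)\<^sup>2"
    unfolding w_def by (rule norm_square_convex_combination[OF assms])
  moreover have lin: "blinfun_apply f w = a * blinfun_apply f x + (1 - a) * blinfun_apply f y"
    for f :: "'a \<Rightarrow>\<^sub>L real"
    by (simp add: w_def blinfun.add_right blinfun.scaleR_right)
  ultimately have "phi w z \<le> a * phi x z + (1 - a) * phi y z"
    unfolding phi_def lin by (simp add: algebra_simps)
  then show ?thesis by (simp add: w_def)
qed

lemma le_add_one_of_square_le:
  fixes t B :: real
  assumes "t\<^sup>2 \<le> B" shows "t \<le> B + 1"
proof -
  have "0 \<le> (t - 1)\<^sup>2" "0 \<le> t\<^sup>2" by auto
  then have "2 * t \<le> t\<^sup>2 + 1" by (simp add: power2_eq_square algebra_simps)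
  then show ?thesis using assms \<open>0 \<le> t\<^sup>2\<close> by linarith
qed

context
  assumes smooth: "uniformly_smooth TYPE('a::banach)" and convex: "uniformly_convex TYPE('a)"
begin

text \<open>
  The values \<open>\<phi> v0 (X n)\<close> of the retractions \<open>X n\<close> increase, as the sets shrink, and are bounded by
  the values on \<open>F\<close>; their increments bound \<open>\<phi> (X i) (X j)\<close> for \<open>i \<le> j\<close>.
\<close>
lemma retractions_onto_shrinking_sets_converge:
  fixes D :: "nat \<Rightarrow> 'a set"
  assumes D: "\<And>n. dual_convex (D n)" "\<And>n. D (Suc n) \<subseteq> D n"
    and F: "F \<noteq> {}" "\<And>n. F \<subseteq> D n"
  obtains u where "(\<lambda>n. sgn_retraction (D n) v0) \<longlonglongrightarrow> u" "\<And>p. p \<in> F \<Longrightarrow> phi v0 u \<le> phi v0 p"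
proof -
  define X where "X = (\<lambda>n. sgn_retraction (D n) v0)"
  define g where "g = (\<lambda>n. phi v0 (X n))"
  have R: "sunny_gn_retraction (sgn_retraction (D n)) (D n)" for n
    using F by (intro sunny_sgn_retraction[OF smooth convex] D) auto
  have X: "X n \<in> D n" for n using R[of n] unfolding X_def sunny_gn_retraction_def by blast
  have dist: "phi (X n) q + g n \<le> phi v0 q" if "q \<in> D n" for q n
    unfolding X_def g_def by (rule sunny_phi_le[OF smooth R that])
  have g_le: "g n \<le> phi v0 p" if "p \<in> F" for p n
    using dist[of p n] F(2)[of n] that phi_nonneg[OF smooth, of "X n" p] by auto
  have D_mono: "D j \<subseteq> D i" if "i \<le> j" for i j
    using that D(2) by (rule lift_Suc_antimono_le[rotated])
  have close: "phi (X i) (X j) \<le> g j - g i" if "i \<le> j" for i j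
    using dist[of "X j" i] X[of j] D_mono[OF that] unfolding g_def by auto
  obtain p0 where p0: "p0 \<in> F" using F by blast
  have "convergent g"
  proof (rule Bseq_mono_convergent)
    show "\<forall>m n. m \<le> n \<longrightarrow> g m \<le> g n"
      using close phi_nonneg[OF smooth] by (meson diff_ge_0_iff_ge order_trans)
    show "Bseq g"
      by (rule BseqI'[of _ "phi v0 p0"])
        (use g_le[OF p0] phi_nonneg[OF smooth] in \<open>auto simp: g_def\<close>)
  qed
  then have "Cauchy g" by (rule convergent_Cauchy)
  define M where "M = norm v0 + phi v0 p0 + 1"
  have bound: "norm (X n) \<le> M" for n
  proof -
    have "(norm (X n) - norm v0)\<^sup>2 \<le> phi v0 p0"
      using alber_ge[of "dmap (X n)" v0] g_le[OF p0, of n]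
      by (simp add: g_def phi_eq_alber[OF smooth] norm_dmap[OF smooth])
    then show ?thesis using le_add_one_of_square_le unfolding M_def by fastforce
  qed
  have "Cauchy X"
  proof (rule CauchyI')
    fix e :: real assume "0 < e"
    then have e: "0 < e / 2" by simp
    from vectors_close[OF convex e, of M] obtain d where d: "0 < d"
      and vc: "\<And>f (x::'a) y. \<lbrakk>norm f \<le> M; alber f x \<le> d; alber f y \<le> d\<rbrakk> \<Longrightarrow> norm (x - y) \<le> e / 2" by metis
    from CauchyD[OF \<open>Cauchy g\<close> d] obtain N where N: "\<And>i j. \<lbrakk>N \<le> i; N \<le> j\<rbrakk> \<Longrightarrow> norm (g i - g j) < d" by blast
    have "dist (X i) (X j) < e" if "N \<le> i" "i < j" for i j
    proof -
      have "alber (dmap (X j)) (X i) \<le> d"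
        using close[of i j] N[of i j] that by (simp add: phi_eq_alber[OF smooth])
      then have "norm (X i - X j) \<le> e / 2"
        using d by (intro vc[of "dmap (X j)"]) (auto simp: norm_dmap[OF smooth] bound alber_dmap_self[OF smooth])
      then show ?thesis using \<open>0 < e\<close> by (simp add: dist_norm)
    qed
    then show "\<exists>M. \<forall>m\<ge>M. \<forall>n>m. dist (X m) (X n) < e" by blast
  qed
  then obtain u where u: "X \<longlonglongrightarrow> u" using Cauchy_convergent convergent_def by blast
  have "g \<longlonglongrightarrow> phi v0 u"
    unfolding g_def by (intro tendsto_phi[OF smooth] tendsto_const u)
  then have "phi v0 u \<le> phi v0 p" if "p \<in> F" for p
    by (rule LIMSEQ_le_const2) (use g_le[OF that] in blast)
  then show thesis using that u unfolding X_def by blast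
qed

text \<open>
  Both \<open>y n\<close> and \<open>v n\<close> have small \<open>V\<close> against the bounded functional \<open>J (v n)\<close>.
\<close>
lemma phi_small_imp_tendsto:
  fixes y v :: "nat \<Rightarrow> 'a"
  assumes v: "v \<longlonglongrightarrow> u" and small: "(\<lambda>n. phi (y n) (v n)) \<longlonglongrightarrow> 0"
  shows "y \<longlonglongrightarrow> u"
proof -
  obtain M where M: "\<And>n. norm (v n) \<le> M"
    using convergent_imp_Bseq[OF convergentI[OF v]] by (auto simp: Bseq_def)
  have "(\<lambda>n. y n - v n) \<longlonglongrightarrow> 0"
  proof (rule LIMSEQ_I)
    fix e :: real assume "0 < e"
    then have e: "0 < e / 2" by simp
    from vectors_close[OF convex e, of M] obtain d where d: "0 < d"
      and vc: "\<And>f (x::'a) y. \<lbrakk>norm f \<le> M; alber f x \<le> d; alber f y \<le> d\<rbrakk> \<Longrightarrow> norm (x - y) \<le> e / 2" by metis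
    from LIMSEQ_D[OF small d] obtain N where N: "\<And>n. N \<le> n \<Longrightarrow> norm (phi (y n) (v n) - 0) < d" by blast
    have "norm (y n - v n - 0) < e" if "N \<le> n" for n
    proof -
      have "norm (y n - v n) \<le> e / 2"
        using N[OF that] d M[of n]
        by (intro vc[of "dmap (v n)"])
          (auto simp: phi_eq_alber[OF smooth] norm_dmap[OF smooth] alber_dmap_self[OF smooth])
      then show ?thesis using \<open>0 < e\<close> by simp
    qed
    then show "\<exists>no. \<forall>n\<ge>no. norm (y n - v n - 0) < e" by blast
  qed
  from tendsto_add[OF this v] show ?thesis by simp
qed

end

theorem theorem3p2:
  fixes T :: "nat \<Rightarrow> 'a::banach \<Rightarrow> 'a"
    and \<Gamma> :: "('a \<Rightarrow> 'a) set"
    and \<alpha> \<beta> \<epsilon> :: "nat \<Rightarrow> real"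
    and \<alpha>bar :: real
    and v0 :: 'a
  assumes "uniformly_smooth TYPE('a)"
    and "uniformly_convex TYPE('a)"
    and "\<forall>S\<in>\<Gamma>. closed_map_graph S \<and> generalized_nonexpansive S"
    and "(\<Inter>k\<in>{1..}. Fix (T k)) = common_fix \<Gamma>"
    and "common_fix \<Gamma> \<noteq> {}"
    and "NST_condition T \<Gamma>"
    and "vanishing_error_phi_Fejer T (common_fix \<Gamma>) \<epsilon>"
    and "\<alpha>bar < 1"
    and "\<forall>k\<ge>1. 0 \<le> \<alpha> k \<and> \<alpha> k \<le> \<alpha>bar"
    and "bounded (\<beta> ` {1..})"
  shows "(\<exists>v w y C. shrinking_iteration T \<alpha> \<beta> \<epsilon> v0 v w y C) \<and>
    (\<forall>v w y C. shrinking_iteration T \<alpha> \<beta> \<epsilon> v0 v w y C \<longrightarrow>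
       (\<forall>k\<ge>1. C k \<noteq> {} \<and> closed (C k) \<and> sunny_gn_retract (C k) \<and>
               (\<exists>!R. sunny_gn_retraction R (C k))) \<and>
       (\<exists>!R. sunny_gn_retraction R (common_fix \<Gamma>)) \<and>
       v \<longlonglongrightarrow> sgn_retraction (common_fix \<Gamma>) v0)"
proof -
  note smooth = assms(1) and convex = assms(2)
  define F where "F = common_fix \<Gamma>"
  have "dual_convex F"
    unfolding F_def common_fix_def
    using assms(3) by (intro dual_convex_Inter dual_convex_Fix[OF smooth convex]) auto
  note F = this assms(5)[folded F_def]
  have \<alpha>: "0 \<le> \<alpha> k" "\<alpha> k \<le> \<alpha>bar" "\<alpha> k \<le> 1" if "1 \<le> k" for k
    using assms(8) assms(9)[rule_format, OF that] by auto
  have \<epsilon>: "\<And>k. 1 \<le> k \<Longrightarrow> 0 \<le> \<epsilon> k" "\<epsilon> \<longlonglongrightarrow> 0"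
    and Fejer: "\<And>x p k. \<lbrakk>p \<in> F; 1 \<le> k\<rbrakk> \<Longrightarrow> phi (T k x) p \<le> phi x p + \<epsilon> k"
    using assms(7) unfolding vanishing_error_phi_Fejer_def F_def by auto
  have "(\<forall>k\<ge>1. C k \<noteq> {} \<and> closed (C k) \<and> sunny_gn_retract (C k) \<and>
               (\<exists>!R. sunny_gn_retraction R (C k))) \<and>
        v \<longlonglongrightarrow> sgn_retraction F v0"
    if iter: "shrinking_iteration T \<alpha> \<beta> \<epsilon> v0 v w y C" for v w y C
  proof -
    from iter have C1: "C 1 = UNIV"
      and w: "\<And>k. 1 \<le> k \<Longrightarrow> w k = v k + \<beta> k *\<^sub>R (v k - v (k - 1))"
      and y: "\<And>k. 1 \<le> k \<Longrightarrow> y k = \<alpha> k *\<^sub>R w k + (1 - \<alpha> k) *\<^sub>R T k (w k)"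
      and C_Suc: "\<And>k. 1 \<le> k \<Longrightarrow> C (Suc k) = C k \<inter> {u. phi (y k) u \<le> phi (w k) u + (1 - \<alpha> k) * \<epsilon> k}"
      and v_Suc: "\<And>k. 1 \<le> k \<Longrightarrow> v (Suc k) = sgn_retraction (C (Suc k)) v0"
      unfolding shrinking_iteration_def by auto

    have C: "dual_convex (C k) \<and> F \<subseteq> C k" if "1 \<le> k" for k
      using that
    proof (induction k rule: dec_induct)
      case base
      then show ?case by (metis C1 dual_convex_UNIV subset_UNIV)
    next
      case (step k)
      have "phi (y k) p \<le> phi (w k) p + (1 - \<alpha> k) * \<epsilon> k" if "p \<in> F" for p
      proof -
        have "phi (y k) p \<le> \<alpha> k * phi (w k) p + (1 - \<alpha> k) * phi (T k (w k)) p"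
          unfolding y[OF step(1)] by (intro phi_convex_combination \<alpha> step(1))
        also have "\<dots> \<le> \<alpha> k * phi (w k) p + (1 - \<alpha> k) * (phi (w k) p + \<epsilon> k)"
          using \<alpha>[OF step(1)] Fejer[OF that step(1)] by (intro add_left_mono mult_left_mono) auto
        finally show ?thesis by (simp add: algebra_simps)
      qed
      then have "F \<subseteq> C (Suc k)" using step.IH C_Suc[OF step(1)] by auto
      moreover have "dual_convex (C (Suc k))"
        unfolding C_Suc[OF step(1)]
        using step.IH by (intro dual_convex_Int dual_convex_phi_le[OF smooth]) auto
      ultimately show ?case by simp
    qed
    have C_nonempty: "C k \<noteq> {}" if "1 \<le> k" for k using C[OF that] F(2) by auto
    have C_retr: "\<exists>!R. sunny_gn_retraction R (C k)" if "1 \<le> k" for k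
      using C[OF that] C_nonempty[OF that] by (intro ex1_sunny_gn_retraction[OF smooth convex]) auto

    have "dual_convex (C (Suc (Suc n)))" "C (Suc (Suc (Suc n))) \<subseteq> C (Suc (Suc n))"
        "F \<subseteq> C (Suc (Suc n))" for n
      using C[of "Suc (Suc n)"] C_Suc[of "Suc (Suc n)"] by auto
    then have "\<exists>u. (\<lambda>n. sgn_retraction (C (Suc (Suc n))) v0) \<longlonglongrightarrow> u \<and> (\<forall>p\<in>F. phi v0 u \<le> phi v0 p)"
      using retractions_onto_shrinking_sets_converge[OF smooth convex, of "\<lambda>n. C (Suc (Suc n))" F] F(2)
      by metis
    then obtain u where tail: "(\<lambda>n. v (Suc (Suc n))) \<longlonglongrightarrow> u" and u_min: "\<And>p. p \<in> F \<Longrightarrow> phi v0 u \<le> phi v0 p"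
      by (auto simp: v_Suc)
    have v: "v \<longlonglongrightarrow> u" using LIMSEQ_imp_Suc[OF LIMSEQ_imp_Suc[OF tail]] .
    have v1: "(\<lambda>n. v (Suc n)) \<longlonglongrightarrow> u" using v by (rule LIMSEQ_Suc)
    \<comment> \<open>The formulas for \<open>w\<close>, \<open>y\<close> and \<open>C\<close> hold from index \<open>1\<close> on, hence the shifted sequences.\<close>
    have w_lim: "(\<lambda>n. w (Suc n)) \<longlonglongrightarrow> u"
    proof -
      obtain B where B: "\<And>k. 1 \<le> k \<Longrightarrow> norm (\<beta> k) \<le> B"
        using assms(10) by (auto simp: bounded_iff)
      have "(\<lambda>n. \<beta> (Suc n) *\<^sub>R (v (Suc n) - v n)) \<longlonglongrightarrow> 0"
      proof (rule Lim_null_comparison)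
        show "\<forall>\<^sub>F n in sequentially. norm (\<beta> (Suc n) *\<^sub>R (v (Suc n) - v n)) \<le> B * norm (v (Suc n) - v n)"
          using B by (intro always_eventually allI) (auto intro!: mult_right_mono)
        have "(\<lambda>n. B * norm (v (Suc n) - v n)) \<longlonglongrightarrow> B * norm (u - u)"
          by (intro tendsto_intros v v1)
        then show "(\<lambda>n. B * norm (v (Suc n) - v n)) \<longlonglongrightarrow> 0" by simp
      qed
      from tendsto_add[OF v1 this] show ?thesis by (simp add: w)
    qed
    have y_lim: "(\<lambda>n. y (Suc n)) \<longlonglongrightarrow> u"
    proof (rule phi_small_imp_tendsto[OF smooth convex tail])
      show "(\<lambda>n. phi (y (Suc n)) (v (Suc (Suc n)))) \<longlonglongrightarrow> 0"
      proof (rule tendsto_sandwich[of "\<lambda>_. 0"])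
        show "\<forall>\<^sub>F n in sequentially. 0 \<le> phi (y (Suc n)) (v (Suc (Suc n)))"
          by (simp add: phi_nonneg[OF smooth])
        \<comment> \<open>The next iterate lies in the set cut out by \<open>y\<close> and \<open>w\<close>.\<close>
        have "phi (y (Suc n)) (v (Suc (Suc n))) \<le> phi (w (Suc n)) (v (Suc (Suc n))) + \<epsilon> (Suc n)" for n
        proof -
          have "sunny_gn_retraction (sgn_retraction (C (Suc (Suc n)))) (C (Suc (Suc n)))"
            using C C_nonempty by (intro sunny_sgn_retraction[OF smooth convex]) auto
          then have "v (Suc (Suc n)) \<in> C (Suc (Suc n))"
            unfolding sunny_gn_retraction_def v_Suc[of "Suc n", simplified] by blast
          then have "phi (y (Suc n)) (v (Suc (Suc n))) \<le>
              phi (w (Suc n)) (v (Suc (Suc n))) + (1 - \<alpha> (Suc n)) * \<epsilon> (Suc n)"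
            using C_Suc[of "Suc n"] by auto
          moreover have "(1 - \<alpha> (Suc n)) * \<epsilon> (Suc n) \<le> 1 * \<epsilon> (Suc n)"
            using \<alpha>[of "Suc n"] \<epsilon>(1)[of "Suc n"] by (intro mult_right_mono) auto
          ultimately show ?thesis by simp
        qed
        then show "\<forall>\<^sub>F n in sequentially. phi (y (Suc n)) (v (Suc (Suc n))) \<le>
            phi (w (Suc n)) (v (Suc (Suc n))) + \<epsilon> (Suc n)" by simp
        have "(\<lambda>n. phi (w (Suc n)) (v (Suc (Suc n))) + \<epsilon> (Suc n)) \<longlonglongrightarrow> phi u u + 0"
          by (intro tendsto_add tendsto_phi[OF smooth] w_lim tail LIMSEQ_Suc[OF \<epsilon>(2)])
        then show "(\<lambda>n. phi (w (Suc n)) (v (Suc (Suc n))) + \<epsilon> (Suc n)) \<longlonglongrightarrow> 0"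
          using phi_eq_0_iff[OF smooth convex, of u u] by simp
      qed simp
    qed
    have "(\<lambda>n. norm (w (Suc n) - T (Suc n) (w (Suc n)))) \<longlonglongrightarrow> 0"
    proof (rule tendsto_sandwich[of "\<lambda>_. 0"])
      have "norm (w k - T k (w k)) \<le> norm (w k - y k) / (1 - \<alpha>bar)" if k: "1 \<le> k" for k
      proof -
        have "w k - y k = (1 - \<alpha> k) *\<^sub>R (w k - T k (w k))" by (simp add: y[OF k] algebra_simps)
        then have "norm (w k - y k) = (1 - \<alpha> k) * norm (w k - T k (w k))" using \<alpha>[OF k] by simp
        moreover have "(1 - \<alpha>bar) * norm (w k - T k (w k)) \<le> (1 - \<alpha> k) * norm (w k - T k (w k))"
          using \<alpha>[OF k] by (intro mult_right_mono) auto
        ultimately show ?thesis using assms(8) by (simp add: pos_le_divide_eq mult.commute)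
      qed
      then show "\<forall>\<^sub>F n in sequentially. norm (w (Suc n) - T (Suc n) (w (Suc n))) \<le>
          norm (w (Suc n) - y (Suc n)) / (1 - \<alpha>bar)" by simp
      have "(\<lambda>n. norm (w (Suc n) - y (Suc n)) / (1 - \<alpha>bar)) \<longlonglongrightarrow> norm (u - u) / (1 - \<alpha>bar)"
        using assms(8) by (intro tendsto_intros w_lim y_lim) auto
      then show "(\<lambda>n. norm (w (Suc n) - y (Suc n)) / (1 - \<alpha>bar)) \<longlonglongrightarrow> 0" by simp
    qed auto
    then have residual: "(\<lambda>k. norm (w k - T k (w k))) \<longlonglongrightarrow> 0" by (rule LIMSEQ_imp_Suc)
    have w_lim': "w \<longlonglongrightarrow> u" using w_lim by (rule LIMSEQ_imp_Suc)
    have "bounded (w ` {1..})"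
      using convergent_imp_bounded[OF w_lim'] by (rule bounded_subset) auto
    with residual assms(6) have NST: "(\<lambda>k. norm (w k - S (w k))) \<longlonglongrightarrow> 0" if "S \<in> \<Gamma>" for S
      using that unfolding NST_condition_def by blast
    have "u \<in> Fix S" if S: "S \<in> \<Gamma>" for S
    proof -
      have "(\<lambda>k. w k - S (w k)) \<longlonglongrightarrow> 0" using NST[OF S] by (rule tendsto_norm_zero_cancel)
      from tendsto_diff[OF w_lim' this] have "(\<lambda>k. S (w k)) \<longlonglongrightarrow> u" by simp
      with w_lim' have "(\<lambda>k. (w k, S (w k))) \<longlonglongrightarrow> (u, u)" by (rule tendsto_Pair)
      moreover have "closed {(x, S x) | x. True}" using assms(3) S unfolding closed_map_graph_def by blast
      ultimately have "(u, u) \<in> {(x, S x) | x. True}" by (rule closed_sequentially[rotated -1]) auto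
      then show ?thesis by (auto simp: Fix_def)
    qed
    then have "u \<in> F" by (simp add: F_def common_fix_def)
    then have "sgn_retraction F v0 = u"
      using u_min by (rule sunny_unique[OF smooth convex sunny_sgn_retraction[OF smooth convex F]])
    then show ?thesis
      using v C C_nonempty C_retr closed_dual_convex[OF smooth] unfolding sunny_gn_retract_def
      by blast
  qed
  then show ?thesis
    using shrinking_iteration_exists ex1_sunny_gn_retraction[OF smooth convex F] unfolding F_def
    by blast
qed

end
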